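(* Let $X$ be a complex Banach space and let $T$ be a frequently hypercyclic bounded linear operator on $X$. Then the spectrum $\sigma(T)$ of $T$ has no isolated points.
   Context: For $A\subseteq\mathbb{Z}_+$ (non-negative integers), the lower density is $\underline{d}(A)=\liminf_{n\to\infty}\frac{|\{m\in A:m\leq n\}|}{n}$. A continuous linear operator $T$ on a topological vector space $X$ is called frequently hypercyclic if there is $x\in X$ such that for every non-empty open $U\subseteq X$ the set $\{n\in\mathbb{N}:T^nx\in U\}$ has positive lower density ($\mathbb{N}$ is the set of positive integers). *)

theory Defs
  imports "HOL-Analysis.Analysis"
begin

text \<open>
  Complex Banach spaces: a \<^class>\<open>banach\<close> space whose real scalar multiplication is the
  restriction of a complex one, the norm being homogeneous for the complex scalars.
\<close>

class complex_normed_vector = real_normed_vector +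
  fixes scaleC :: "complex \<Rightarrow> 'a \<Rightarrow> 'a"  (infixr \<open>*\<^sub>C\<close> 75)
  assumes scaleC_add_right: "a *\<^sub>C (x + y) = a *\<^sub>C x + a *\<^sub>C y"
    and scaleC_add_left: "(a + b) *\<^sub>C x = a *\<^sub>C x + b *\<^sub>C x"
    and scaleC_scaleC: "a *\<^sub>C (b *\<^sub>C x) = (a * b) *\<^sub>C x"
    and scaleC_one: "1 *\<^sub>C x = x"
    and scaleR_scaleC: "r *\<^sub>R x = complex_of_real r *\<^sub>C x"
    and norm_scaleC: "norm (a *\<^sub>C x) = cmod a * norm x"

class complex_banach = complex_normed_vector + banach

instantiation complex :: complex_banach
begin

definition scaleC_complex :: "complex \<Rightarrow> complex \<Rightarrow> complex"
  where "scaleC_complex a x = a * x"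

instance
  by standard (simp_all add: scaleC_complex_def algebra_simps scaleR_conv_of_real norm_mult)

end

interpretation complex_vector:
  vector_space "scaleC :: complex \<Rightarrow> 'a \<Rightarrow> 'a::complex_normed_vector"
  by standard (simp_all add: scaleC_add_right scaleC_add_left scaleC_scaleC scaleC_one)

definition bounded_clinear ::
    "('a::complex_normed_vector \<Rightarrow> 'b::complex_normed_vector) \<Rightarrow> bool"
  where "bounded_clinear T \<longleftrightarrow>
    Vector_Spaces.linear scaleC scaleC T \<and> (\<exists>K. \<forall>x. norm (T x) \<le> norm x * K)"

lemma bounded_clinear_imp_bounded_linear:
  assumes "bounded_clinear T"
  shows "bounded_linear T"
proof -
  interpret Vector_Spaces.linear scaleC scaleC T
    using assms by (simp add: bounded_clinear_def)
  show ?thesis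
    using assms by unfold_locales (auto simp: bounded_clinear_def add scale scaleR_scaleC)
qed

definition spectrum :: "('a::complex_normed_vector \<Rightarrow> 'a) \<Rightarrow> complex set"
  where "spectrum T = {z. \<not> (\<exists>S. bounded_clinear S \<and>
    (\<lambda>x. T x - z *\<^sub>C x) \<circ> S = id \<and> S \<circ> (\<lambda>x. T x - z *\<^sub>C x) = id)}"

text \<open>
  The term at \<open>n = 0\<close> is \<open>0\<close> by the convention for division by zero; the lower limit does not
  depend on it.
\<close>

definition lower_density :: "nat set \<Rightarrow> ereal"
  where "lower_density A = liminf (\<lambda>n. ereal (real (card {m \<in> A. m \<le> n}) / real n))"

text \<open>The definition below is meant for continuous linear \<open>T\<close>, which is not required here.\<close>

definition frequently_hypercyclic :: "('a::topological_space \<Rightarrow> 'a) \<Rightarrow> bool"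
  where "frequently_hypercyclic T \<longleftrightarrow>
    (\<exists>x. \<forall>U. open U \<and> U \<noteq> {} \<longrightarrow> lower_density {n. 1 \<le> n \<and> (T ^^ n) x \<in> U} > 0)"

end

theory Submission
  imports Defs "HOL-Complex_Analysis.Complex_Analysis"
begin

text \<open>
  Let \<open>l\<close> be an isolated point of \<open>\<sigma>(T)\<close>, let \<open>R(z)\<close> be the inverse of \<open>T - z\<close>, and let \<open>\<phi>\<close> be a
  bounded functional. Integrating over a small circle \<open>\<Gamma>\<close> around \<open>l\<close> gives the functional
  \<open>\<psi>(x) = \<integral>\<^sub>\<Gamma> \<phi>(R(z) x) dz\<close>, which is \<open>\<phi>\<close> composed with a multiple of the Riesz projection
  belonging to \<open>{l}\<close>, and \<open>\<psi>(T^n x) = \<integral>\<^sub>\<Gamma> z^n \<phi>(R(z) x) dz\<close>. If \<open>\<psi>\<close> vanished for all \<open>\<phi>\<close>, the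
  resolvent would stay bounded near \<open>l\<close> and \<open>l\<close> would not be in the spectrum
  (\<open>moment_nonzero\<close>; the functionals come from the Hahn-Banach theorem). So some \<open>\<psi>\<close> is nonzero.
  
  If \<open>l = 0\<close>, a circle of radius less than \<open>1\<close> shows that \<open>\<psi>(T^n x)\<close> is bounded in \<open>n\<close>, and no orbit is
  dense. If \<open>l \<noteq> 0\<close>, the function \<open>f(z) = \<integral>\<^sub>\<Gamma> exp(z Ln(s/l)) \<phi>(R(s) x) ds\<close> is entire with
  \<open>f(n) = \<psi>(T^n x) / l^n\<close>. As \<open>\<Gamma>\<close> can be shrunk to \<open>l\<close>, where \<open>Ln(s/l)\<close> vanishes, \<open>f\<close> has
  exponential type zero (\<open>circle_integral_exp_type_zero\<close>). Such a function has only \<open>o(r)\<close> zeros in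
  the disc of radius \<open>r\<close>, so along the integers the real parts of \<open>f\<close> and of \<open>-\<i> f\<close> change
  sign only on a set of density zero (\<open>exp_type_zero_sign_changes\<close>).
  
  Frequent hypercyclicity makes sign changes too frequent for this. A functional on a space with a
  dense orbit cannot be an eigenvector of the adjoint of \<open>T\<close>, so \<open>\<psi>\<close> and \<open>\<psi> \<circ> T\<close> are
  linearly independent and the open set \<open>U\<close> of all \<open>y\<close> with \<open>\<psi>(y)\<close> close to \<open>-1\<close> and
  \<open>\<psi>(T y) / l\<close> close to \<open>1\<close> is nonempty. If \<open>T^n x \<in> U\<close>, then
  \<open>f(n) \<approx> -l^(-n)\<close> and \<open>f(n + 1) \<approx> l^(-n)\<close>, so that between \<open>n\<close> and \<open>n + 1\<close> the real part of
  \<open>f\<close> or that of \<open>-\<i> f\<close> changes sign. For a frequently hypercyclic \<open>x\<close> these \<open>n\<close> have positive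
  lower density, a contradiction.
\<close>

section \<open>Zeros of entire functions of exponential type zero\<close>

definition exp_type_zero :: "(complex \<Rightarrow> complex) \<Rightarrow> bool"
  where "exp_type_zero f \<longleftrightarrow> f holomorphic_on UNIV \<and>
    (\<forall>e>0. \<exists>C. \<forall>z. norm (f z) \<le> C * exp (e * norm z))"

lemma entire_divide_zeros:
  assumes "finite Z" "G holomorphic_on UNIV" "\<And>a. a \<in> Z \<Longrightarrow> G a = 0"
  shows "\<exists>H. H holomorphic_on UNIV \<and> (\<forall>z. G z = H z * (\<Prod>a\<in>Z. z - a))"
  using assms
proof (induction Z rule: finite_induct)
  case empty
  then show ?case by auto
next
  case (insert a Z)
  then obtain H where H: "H holomorphic_on UNIV" "\<And>z. G z = H z * (\<Prod>a\<in>Z. z - a)"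
    by auto
  have "G a = 0" using insert by auto
  moreover have "(\<Prod>b\<in>Z. a - b) \<noteq> 0" using insert by auto
  ultimately have Ha: "H a = 0" using H(2)[of a] by auto
  define K where "K = (\<lambda>z. if z = a then deriv H a else (H z - H a) / (z - a))"
  have "K holomorphic_on UNIV"
    unfolding K_def by (rule pole_lemma_open[OF H(1) open_UNIV])
  moreover have "G z = K z * (\<Prod>a\<in>insert a Z. z - a)" for z
    using insert.hyps H(2)[of z] Ha by (auto simp: K_def)
  ultimately show ?case by blast
qed

text \<open>
  A form of Jensen's inequality. After division by \<open>\<Prod>(z - b)\<close> over the zeros \<open>b\<close>, the maximum
  principle compares the centre with the circle of radius \<open>3 r\<close>: there every factor has modulus at
  least \<open>2 r\<close>, while at the centre it is at most \<open>r\<close>. So each zero gains a factor \<open>2\<close>.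
\<close>

lemma entire_card_zeros_le:
  assumes G: "G holomorphic_on UNIV" and Z: "finite Z" "Z \<subseteq> cball a r" "\<And>z. z \<in> Z \<Longrightarrow> G z = 0"
    and r: "r > 0" and B: "\<And>z. z \<in> sphere a (3 * r) \<Longrightarrow> norm (G z) \<le> B"
  shows "norm (G a) * 2 ^ card Z \<le> B"
proof -
  obtain H where H: "H holomorphic_on UNIV" "\<And>z. G z = H z * (\<Prod>b\<in>Z. z - b)"
    using entire_divide_zeros[OF Z(1) G Z(3)] by blast
  define m where "m = card Z"
  have le_frontier: "norm (H z) \<le> B / (2 * r) ^ m" if "z \<in> frontier (ball a (3 * r))" for z
  proof -
    have z: "dist a z = 3 * r" using that r by simp
    have "2 * r \<le> norm (z - b)" if "b \<in> Z" for b
    proof -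
      have "dist a b \<le> r" using Z(2) that by auto
      then show ?thesis using z dist_triangle[of a z b] by (simp add: dist_norm norm_minus_commute)
    qed
    then have "(\<Prod>b\<in>Z. 2 * r) \<le> (\<Prod>b\<in>Z. norm (z - b))"
      using r by (intro prod_mono) auto
    then have "(2 * r) ^ m \<le> norm (\<Prod>b\<in>Z. z - b)" by (simp add: m_def prod_norm)
    then have "norm (H z) * (2 * r) ^ m \<le> norm (G z)"
      unfolding H(2) norm_mult by (intro mult_left_mono) auto
    also have "\<dots> \<le> B" using B z by auto
    finally show ?thesis using r by (simp add: field_simps)
  qed
  have Ha: "norm (H a) \<le> B / (2 * r) ^ m"
  proof (rule maximum_modulus_frontier[of H "ball a (3 * r)"])
    show "H holomorphic_on interior (ball a (3 * r))"
      using H(1) by (rule holomorphic_on_subset) simp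
    show "continuous_on (closure (ball a (3 * r))) H"
      using holomorphic_on_imp_continuous_on[OF H(1)] by (rule continuous_on_subset) simp
  qed (use r le_frontier in auto)
  have "(\<Prod>b\<in>Z. norm (a - b)) \<le> (\<Prod>b\<in>Z. r)"
    using Z(2) by (intro prod_mono) (auto simp: dist_norm)
  then have "norm (G a) \<le> norm (H a) * r ^ m"
    unfolding H(2) norm_mult by (intro mult_left_mono) (auto simp: m_def prod_norm)
  also have "\<dots> \<le> B / (2 * r) ^ m * r ^ m"
    using Ha r by (intro mult_right_mono) auto
  also have "\<dots> = B / 2 ^ m" using r by (simp add: power_mult_distrib)
  finally show ?thesis by (simp add: field_simps m_def)
qed

text \<open>
  Jensen's inequality with the bound \<open>C exp(e |z|)\<close> allows \<open>O(1) + (3 e / ln 2) r\<close> zeros, for every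
  \<open>e > 0\<close>. The point \<open>a\<close> serves as centre because \<open>f 0\<close> may be zero.
\<close>

lemma exp_type_zero_card_zeros:
  assumes f: "exp_type_zero f" and a: "f a \<noteq> 0" and \<delta>: "\<delta> > 0"
  shows "\<exists>N. \<forall>r\<ge>N. \<forall>Z. finite Z \<and> Z \<subseteq> cball 0 r \<and> (\<forall>z\<in>Z. f z = 0) \<longrightarrow> real (card Z) \<le> \<delta> * r"
proof -
  \<comment> \<open>With this \<open>e\<close> the linear term \<open>3 e r / ln 2\<close> is half of \<open>\<delta> r\<close>.\<close>
  define e where "e = \<delta> * ln 2 / 6"
  have "e > 0" using \<delta> by (simp add: e_def)
  then obtain C where C: "\<And>z. norm (f z) \<le> C * exp (e * norm z)"
    using f unfolding exp_type_zero_def by blast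
  have "0 < norm (f a)" using a by simp
  also have "\<dots> \<le> C * exp (e * norm a)" by (rule C)
  finally have C0: "C > 0" by (simp add: zero_less_mult_iff)
  define K where "K = (ln C + 4 * e * norm a - ln (norm (f a))) / ln 2"
  show ?thesis
  proof (intro exI[of _ "max 1 (2 * K / \<delta>)"] allI impI, elim conjE)
    fix r Z assume r: "max 1 (2 * K / \<delta>) \<le> r" and Z: "finite Z" "Z \<subseteq> cball 0 r" "\<forall>z\<in>Z. f z = 0"
    define s where "s = r + norm a"
    have "norm (f z) \<le> C * exp (e * (3 * r + 4 * norm a))" if "z \<in> sphere a (3 * s)" for z
    proof -
      have "norm z \<le> norm a + norm (z - a)" by (metis norm_triangle_sub)
      then have "norm z \<le> 3 * r + 4 * norm a"
        using that by (simp add: s_def dist_norm norm_minus_commute)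
      then have "C * exp (e * norm z) \<le> C * exp (e * (3 * r + 4 * norm a))"
        using C0 \<open>e > 0\<close> by simp
      then show ?thesis using C[of z] by linarith
    qed
    moreover have "Z \<subseteq> cball a s"
    proof
      fix z assume "z \<in> Z"
      then have "norm z \<le> r" using Z(2) by auto
      then show "z \<in> cball a s" using norm_triangle_ineq4[of a z] by (simp add: s_def dist_norm)
    qed
    moreover have "s > 0" using r by (simp add: s_def add_pos_nonneg)
    ultimately have "norm (f a) * 2 ^ card Z \<le> C * exp (e * (3 * r + 4 * norm a))"
      using f Z by (intro entire_card_zeros_le) (auto simp: exp_type_zero_def)
    then have "ln (norm (f a) * 2 ^ card Z) \<le> ln (C * exp (e * (3 * r + 4 * norm a)))"
      using a C0 by (subst ln_le_cancel_iff) auto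
    then have "ln (norm (f a)) + card Z * ln 2 \<le> ln C + e * (3 * r + 4 * norm a)"
      using a C0 by (simp add: ln_mult ln_realpow)
    moreover have "K * ln 2 = ln C + 4 * e * norm a - ln (norm (f a))"
      by (simp add: K_def)
    moreover have "\<delta> * r / 2 * ln 2 = 3 * e * r"
      by (simp add: e_def)
    ultimately have "card Z * ln 2 \<le> (K + \<delta> * r / 2) * ln 2"
      unfolding distrib_right distrib_left by linarith
    then have "card Z \<le> K + \<delta> * r / 2" by simp
    moreover have "2 * K \<le> \<delta> * r" using r \<delta> by (simp add: field_simps)
    ultimately show "real (card Z) \<le> \<delta> * r" by linarith
  qed
qed

text \<open>
  On the real axis \<open>Re f\<close> agrees with an entire function \<open>g\<close> that is again of exponential type zero,
  so each sign change produces a zero of \<open>g\<close> by the intermediate value theorem. Products that are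
  strictly negative keep these zeros in disjoint open intervals and rule out \<open>g = 0\<close>.
\<close>

lemma exp_type_zero_sign_changes:
  assumes f: "exp_type_zero f" and \<delta>: "\<delta> > 0"
  shows "\<exists>N. \<forall>n\<ge>N. real (card {m. Re (f (of_nat m)) * Re (f (of_nat (Suc m))) < 0 \<and> m \<le> n}) \<le> \<delta> * real n"
proof -
  define B where "B = {m. Re (f (of_nat m)) * Re (f (of_nat (Suc m))) < 0}"
  define g where "g = (\<lambda>z. (f z + cnj (f (cnj z))) / 2)"
  have fhol: "f holomorphic_on UNIV" using f by (simp add: exp_type_zero_def)
  have "(cnj \<circ> f \<circ> cnj) holomorphic_on UNIV"
    using fhol by (subst holomorphic_on_compose_cnj_cnj) auto
  then have ghol: "g holomorphic_on UNIV"
    unfolding g_def o_def using fhol by (intro holomorphic_intros) auto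
  have "exp_type_zero g"
    unfolding exp_type_zero_def
  proof (intro conjI ghol allI impI)
    fix e :: real assume "e > 0"
    then obtain C where C: "\<And>z. norm (f z) \<le> C * exp (e * norm z)"
      using f unfolding exp_type_zero_def by blast
    have "norm (g z) \<le> C * exp (e * norm z)" for z
      using norm_triangle_ineq[of "f z" "cnj (f (cnj z))"] C[of z] C[of "cnj z"]
      by (simp add: g_def norm_divide)
    then show "\<exists>C. \<forall>z. norm (g z) \<le> C * exp (e * norm z)" by blast
  qed
  have greal: "g (of_real t) = of_real (Re (f (of_real t)))" for t
    by (simp add: g_def complex_eq_iff)
  have cont: "continuous_on A (\<lambda>t::real. Re (f (of_real t)))" for A
    by (intro continuous_intros continuous_on_compose2[OF holomorphic_on_imp_continuous_on[OF fhol]]) auto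
  have zero: "\<exists>t. real m < t \<and> t < real (Suc m) \<and> g (of_real t) = 0" if "m \<in> B" for m
  proof -
    let ?h = "\<lambda>t::real. Re (f (of_real t))"
    have sg: "?h (real m) * ?h (real (Suc m)) < 0" using that by (simp add: B_def)
    have "\<exists>t. real m \<le> t \<and> t \<le> real (Suc m) \<and> ?h t = 0"
    proof (cases "?h (real m) < 0")
      case True
      then have "?h (real (Suc m)) > 0" using sg by (simp add: mult_less_0_iff)
      then show ?thesis using True by (intro IVT' cont) auto
    next
      case False
      then have "?h (real (Suc m)) < 0" "?h (real m) > 0" using sg by (auto simp: mult_less_0_iff)
      then show ?thesis by (intro IVT2' cont) auto
    qed
    then obtain t where t: "real m \<le> t" "t \<le> real (Suc m)" "?h t = 0" by blast
    have "t \<noteq> real m" "t \<noteq> real (Suc m)" using t(3) sg by auto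
    then show ?thesis using t greal[of t] by (intro exI[of _ t]) auto
  qed
  show ?thesis
  proof (cases "B = {}")
    case True
    then have E: "{m. Re (f (of_nat m)) * Re (f (of_nat (Suc m))) < 0 \<and> m \<le> n} = {}" for n
      by (auto simp: B_def)
    show ?thesis unfolding E using \<delta> by auto
  next
    case False
    then obtain k where "k \<in> B" by blast
    then have "Re (f (of_nat k)) \<noteq> 0" by (auto simp: B_def)
    then have "g (of_real (real k)) \<noteq> 0" unfolding greal by simp
    then obtain N where N: "\<And>r Z. \<lbrakk>r \<ge> N; finite Z; Z \<subseteq> cball 0 r; \<And>z. z \<in> Z \<Longrightarrow> g z = 0\<rbrakk>
        \<Longrightarrow> real (card Z) \<le> \<delta> / 2 * r"
      using exp_type_zero_card_zeros[OF \<open>exp_type_zero g\<close>, of _ "\<delta> / 2"] \<delta> by (metis half_gt_zero)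
    from zero obtain t where t: "\<And>m. m \<in> B \<Longrightarrow> real m < t m \<and> t m < real (Suc m) \<and> g (of_real (t m)) = 0"
      by metis
    show ?thesis
    proof (intro exI[of _ "max 1 (nat \<lceil>N\<rceil>)"] allI impI)
      fix n assume n: "max 1 (nat \<lceil>N\<rceil>) \<le> n"
      let ?A = "{m. Re (f (of_nat m)) * Re (f (of_nat (Suc m))) < 0 \<and> m \<le> n}"
      have A: "?A = B \<inter> {..n}" by (auto simp: B_def)
      let ?Z = "(\<lambda>m. complex_of_real (t m)) ` (B \<inter> {..n})"
      have "inj_on (\<lambda>m. complex_of_real (t m)) (B \<inter> {..n})"
      proof (rule inj_onI)
        fix m m' assume "m \<in> B \<inter> {..n}" "m' \<in> B \<inter> {..n}" "complex_of_real (t m) = complex_of_real (t m')"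
        then show "m = m'" using t[of m] t[of m'] by auto
      qed
      then have "card ?A = card ?Z" unfolding A by (simp add: card_image)
      also have "real (card ?Z) \<le> \<delta> / 2 * (real n + 1)"
      proof (rule N)
        show "?Z \<subseteq> cball 0 (real n + 1)"
        proof (safe)
          fix m assume "m \<in> B" "m \<le> n"
          then show "complex_of_real (t m) \<in> cball 0 (real n + 1)" using t[of m] by auto
        qed
        show "N \<le> real n + 1" using n by linarith
      qed (use t in auto)
      also have "\<dots> \<le> \<delta> * real n" using n \<delta> by (simp add: field_simps)
      finally show "real (card ?A) \<le> \<delta> * real n" .
    qed
  qed
qed

section \<open>Norming functionals\<close>

text \<open>
  The Hahn-Banach theorem is obtained from minimal sublinear functionals: Zorn's lemma applies to
  functionals on the whole space, in place of partially defined linear ones. Domination by the norm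
  also bounds them below, by \<open>- norm x\<close>, so that infima of chains exist.
\<close>

definition dominated_sublinear :: "('a::real_normed_vector \<Rightarrow> real) \<Rightarrow> bool"
  where "dominated_sublinear p \<longleftrightarrow> (\<forall>x y. p (x + y) \<le> p x + p y) \<and> (\<forall>c x. 0 < c \<longrightarrow> p (c *\<^sub>R x) = c * p x) \<and>
    (\<forall>x. p x \<le> norm x)"

lemma dominated_sublinear_zero: "dominated_sublinear p \<Longrightarrow> p 0 = 0"
proof -
  assume p: "dominated_sublinear p"
  then have "p (2 *\<^sub>R 0) = 2 * p 0" unfolding dominated_sublinear_def by (metis zero_less_numeral)
  then show ?thesis by simp
qed

lemma dominated_sublinear_lower: "dominated_sublinear p \<Longrightarrow> - norm x \<le> p x"
proof -
  assume p: "dominated_sublinear p"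
  have "0 \<le> p x + p (- x)"
    using p dominated_sublinear_zero[OF p] unfolding dominated_sublinear_def by (metis add.right_inverse)
  moreover have "p (- x) \<le> norm x"
    using p unfolding dominated_sublinear_def by (metis norm_minus_cancel)
  ultimately show ?thesis by linarith
qed

lemma dominated_sublinear_INF_chain:
  assumes C: "C \<noteq> {}" "\<And>p. p \<in> C \<Longrightarrow> dominated_sublinear p" "\<And>p q. p \<in> C \<Longrightarrow> q \<in> C \<Longrightarrow> p \<le> q \<or> q \<le> p"
  shows "dominated_sublinear (\<lambda>x. INF p\<in>C. p x)" "\<And>p x. p \<in> C \<Longrightarrow> (INF p\<in>C. p x) \<le> p x"
proof -
  have bdd: "bdd_below ((\<lambda>p. p x) ` C)" for x
    using dominated_sublinear_lower[OF C(2)] by (intro bdd_belowI2[of _ "- norm x"]) auto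
  show le: "(INF p\<in>C. p x) \<le> p x" if "p \<in> C" for p x
    using bdd that by (rule cINF_lower)
  show "dominated_sublinear (\<lambda>x. INF p\<in>C. p x)"
    unfolding dominated_sublinear_def
  proof (intro conjI allI impI)
    fix x y
    have "(INF p\<in>C. p (x + y)) - p x \<le> q y" if pq: "p \<in> C" "q \<in> C" for p q
    proof -
      obtain r where r: "r \<in> C" "r \<le> p" "r \<le> q" using C(3)[OF pq] pq by blast
      have "(INF p\<in>C. p (x + y)) \<le> r (x + y)" using r by (intro le)
      also have "\<dots> \<le> r x + r y" using C(2)[OF r(1)] by (simp add: dominated_sublinear_def)
      also have "\<dots> \<le> p x + q y" using r by (intro add_mono) (auto simp: le_fun_def)
      finally show ?thesis by simp
    qed
    then have "(INF p\<in>C. p (x + y)) - p x \<le> (INF q\<in>C. q y)" if "p \<in> C" for p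
      using C(1) that by (intro cINF_greatest) auto
    then have "(INF p\<in>C. p (x + y)) - (INF q\<in>C. q y) \<le> p x" if "p \<in> C" for p
      using that by (simp add: algebra_simps)
    then have "(INF p\<in>C. p (x + y)) - (INF q\<in>C. q y) \<le> (INF p\<in>C. p x)"
      using C(1) by (intro cINF_greatest) auto
    then show "(INF p\<in>C. p (x + y)) \<le> (INF p\<in>C. p x) + (INF q\<in>C. q y)" by simp
  next
    fix c :: real and x assume c: "c > 0"
    have sc: "p (c *\<^sub>R x) = c * p x" if "p \<in> C" for p
      using C(2)[OF that] c by (simp add: dominated_sublinear_def)
    show "(INF p\<in>C. p (c *\<^sub>R x)) = c * (INF p\<in>C. p x)"
    proof (rule antisym)
      have "(INF p\<in>C. p (c *\<^sub>R x)) / c \<le> (INF p\<in>C. p x)"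
      proof (rule cINF_greatest)
        fix p assume "p \<in> C"
        then show "(INF p\<in>C. p (c *\<^sub>R x)) / c \<le> p x"
          using le[of p "c *\<^sub>R x"] sc[of p] c by (simp add: field_simps)
      qed (use C in auto)
      then show "(INF p\<in>C. p (c *\<^sub>R x)) \<le> c * (INF p\<in>C. p x)" using c by (simp add: field_simps)
      show "c * (INF p\<in>C. p x) \<le> (INF p\<in>C. p (c *\<^sub>R x))"
      proof (rule cINF_greatest)
        fix p assume "p \<in> C"
        then show "c * (INF p\<in>C. p x) \<le> p (c *\<^sub>R x)"
          using le[of p x] sc[of p] c by simp
      qed (use C in auto)
    qed
  next
    fix x
    obtain p where "p \<in> C" using C(1) by blast
    then show "(INF p\<in>C. p x) \<le> norm x"
      using le[of p x] C(2)[of p] unfolding dominated_sublinear_def by (meson order_trans)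
  qed
qed

text \<open>
  This makes a sublinear functional smaller, as small as additivity along \<open>y\<close> demands. A minimal
  \<open>p\<close> cannot change, which gives \<open>p x + p y \<le> p (x + y)\<close>; so minimal functionals are linear.
  The witness is \<open>q x = inf\<^sub>t (p (x + t y) - t p y)\<close> over \<open>t \<ge> 0\<close>.
\<close>

lemma dominated_sublinear_push:
  assumes p: "dominated_sublinear p"
  shows "\<exists>q. dominated_sublinear q \<and> q \<le> p \<and> (\<forall>x. q x \<le> p (x + y) - p y)"
proof -
  define q where "q = (\<lambda>x. INF t\<in>{0..}. p (x + t *\<^sub>R y) - t * p y)"
  have padd: "p (u + v) \<le> p u + p v" for u v using p by (simp add: dominated_sublinear_def)
  have psc: "0 \<le> t \<Longrightarrow> p (t *\<^sub>R u) = t * p u" for t u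
    using p dominated_sublinear_zero[OF p] by (cases "t = 0") (auto simp: dominated_sublinear_def)
  have lower: "- p (- x) \<le> p (x + t *\<^sub>R y) - t * p y" if "t \<ge> 0" for x t
    using padd[of "x + t *\<^sub>R y" "- x"] psc[OF that, of y] by simp
  have qle: "q x \<le> p (x + t *\<^sub>R y) - t * p y" if "t \<ge> 0" for x t
    unfolding q_def using that lower by (intro cINF_lower bdd_belowI2[of _ "- p (- x)"]) auto
  have qge: "(\<And>t. t \<ge> 0 \<Longrightarrow> a \<le> p (x + t *\<^sub>R y) - t * p y) \<Longrightarrow> a \<le> q x" for a x
    unfolding q_def by (intro cINF_greatest) auto
  have qp: "q x \<le> p x" for x using qle[of 0 x] by simp
  have "dominated_sublinear q"
    unfolding dominated_sublinear_def
  proof (intro conjI allI impI)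
    fix u v
    have "q (u + v) - (p (u + t *\<^sub>R y) - t * p y) \<le> q v" if t: "t \<ge> 0" for t
    proof (rule qge)
      fix s :: real assume s: "s \<ge> 0"
      have "q (u + v) \<le> p ((u + v) + (t + s) *\<^sub>R y) - (t + s) * p y"
        using t s by (intro qle) auto
      also have "(u + v) + (t + s) *\<^sub>R y = (u + t *\<^sub>R y) + (v + s *\<^sub>R y)"
        by (simp add: algebra_simps)
      also have "p \<dots> \<le> p (u + t *\<^sub>R y) + p (v + s *\<^sub>R y)" by (rule padd)
      finally show "q (u + v) - (p (u + t *\<^sub>R y) - t * p y) \<le> p (v + s *\<^sub>R y) - s * p y"
        by (simp add: algebra_simps)
    qed
    then have "q (u + v) - q v \<le> q u" by (intro qge) (simp add: algebra_simps)
    then show "q (u + v) \<le> q u + q v" by simp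
  next
    have le: "q (c *\<^sub>R x) \<le> c * q x" if c: "c > 0" for c x
    proof -
      have "q (c *\<^sub>R x) / c \<le> q x"
      proof (rule qge)
        fix t :: real assume t: "t \<ge> 0"
        have "q (c *\<^sub>R x) \<le> p (c *\<^sub>R x + (c * t) *\<^sub>R y) - c * t * p y"
          using t c by (intro qle) auto
        also have "c *\<^sub>R x + (c * t) *\<^sub>R y = c *\<^sub>R (x + t *\<^sub>R y)" by (simp add: algebra_simps)
        also have "p \<dots> = c * p (x + t *\<^sub>R y)" using c by (intro psc) auto
        finally show "q (c *\<^sub>R x) / c \<le> p (x + t *\<^sub>R y) - t * p y" using c by (simp add: field_simps)
      qed
      then show ?thesis using c by (simp add: field_simps)
    qed
    fix c :: real and x assume c: "c > 0"
    have "q x \<le> (1 / c) * q (c *\<^sub>R x)" using le[of "1 / c" "c *\<^sub>R x"] c by simp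
    then have "c * q x \<le> q (c *\<^sub>R x)" using c by (simp add: field_simps)
    then show "q (c *\<^sub>R x) = c * q x" using le[OF c, of x] by simp
  next
    fix x show "q x \<le> norm x" using qp[of x] p unfolding dominated_sublinear_def by (meson order_trans)
  qed
  moreover have "q x \<le> p (x + y) - p y" for x using qle[of 1 x] by simp
  ultimately show ?thesis using qp by (auto simp: le_fun_def)
qed

text \<open>
  The norm is first pushed along \<open>x0\<close>, which forces \<open>q (- x0) \<le> - norm x0\<close>; any minimal functional
  below \<open>q\<close> is then linear and attains the norm at \<open>x0\<close>.
\<close>

lemma real_norming_functional:
  fixes x0 :: "'a::real_normed_vector"
  shows "\<exists>f. linear f \<and> (\<forall>x. f x \<le> norm x) \<and> norm x0 \<le> f x0"
proof -
  have "dominated_sublinear (norm :: 'a \<Rightarrow> real)"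
    by (auto simp: dominated_sublinear_def norm_triangle_ineq)
  then obtain q where q: "dominated_sublinear q" "\<And>x. q x \<le> norm (x + x0) - norm x0"
    using dominated_sublinear_push[of norm x0] by blast
  define A where "A = {p. dominated_sublinear p \<and> p \<le> q}"
  define P where "P = (\<lambda>p p' :: 'a \<Rightarrow> real. p' \<le> p)"
  have "\<exists>m \<in> A. \<forall>a \<in> A. P m a \<longrightarrow> a = m"
  proof (rule predicate_Zorn)
    show "partial_order_on A (relation_of P A)"
      by (rule partial_order_on_relation_ofI) (auto simp: P_def)
    fix C assume C: "C \<in> Chains (relation_of P A)"
    show "\<exists>u\<in>A. \<forall>a\<in>C. P a u"
    proof (cases "C = {}")
      case True
      then show ?thesis using q by (auto simp: A_def)
    next
      case False
      have CA: "C \<subseteq> A" using C by (auto simp: Chains_def relation_of_def)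
      have ch: "p \<le> p' \<or> p' \<le> p" if "p \<in> C" "p' \<in> C" for p p'
        using C that by (auto simp: Chains_def relation_of_def P_def)
      let ?u = "\<lambda>x. INF p\<in>C. p x"
      have sub: "dominated_sublinear ?u"
        using False CA ch by (intro dominated_sublinear_INF_chain(1)) (auto simp: A_def)
      have le: "?u \<le> p" if "p \<in> C" for p
        unfolding le_fun_def
      proof
        fix x show "(INF p\<in>C. p x) \<le> p x"
          using False CA ch that by (intro dominated_sublinear_INF_chain(2)) (auto simp: A_def)
      qed
      obtain p where "p \<in> C" using False by blast
      then have "?u \<le> q" using le[of p] CA by (auto simp: A_def intro: order_trans)
      then show ?thesis using sub le by (auto simp: A_def P_def intro!: bexI[of _ ?u])
    qed
  qed
  then obtain f where f: "dominated_sublinear f" "f \<le> q" and min: "\<And>p. dominated_sublinear p \<Longrightarrow> p \<le> f \<Longrightarrow> p = f"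
    unfolding A_def P_def by (auto intro: order_trans)
  have add: "f (x + y) = f x + f y" for x y
  proof -
    obtain g where "dominated_sublinear g" "g \<le> f" "\<And>x. g x \<le> f (x + y) - f y"
      using dominated_sublinear_push[OF f(1), of y] by blast
    then have "f x \<le> f (x + y) - f y" using min[of g] by auto
    then show ?thesis using f(1) by (auto simp: dominated_sublinear_def intro: antisym)
  qed
  have minus: "f (- x) = - f x" for x
    using add[of x "- x"] dominated_sublinear_zero[OF f(1)] by simp
  have scale: "f (c *\<^sub>R x) = c *\<^sub>R f x" for c x
  proof -
    have pos: "0 < c \<Longrightarrow> f (c *\<^sub>R x) = c * f x" for c x using f(1) by (simp add: dominated_sublinear_def)
    consider "c = 0" | "c > 0" | "c < 0" by linarith
    then show ?thesis
      using pos[of c x] pos[of "- c" x] minus[of "c *\<^sub>R x"] dominated_sublinear_zero[OF f(1)]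
      by cases auto
  qed
  have "f (- x0) \<le> - norm x0"
    using f(2) q(2)[of "- x0"] by (auto simp: le_fun_def intro: order_trans)
  then have "norm x0 \<le> f x0" using minus by simp
  moreover have "f x \<le> norm x" for x using f(1) by (simp add: dominated_sublinear_def)
  ultimately show ?thesis
    using add scale by (intro exI[of _ f] conjI linearI) auto
qed

text \<open>
  A real functional \<open>f\<close> is the real part of the complex one \<open>x \<mapsto> f x - \<i> f (\<i> x)\<close>. Its norm
  is the norm of \<open>f\<close>, but the factor \<open>2\<close>, immediate from the two components, is good enough below.
\<close>

lemma complex_norming_functional:
  fixes x0 :: "'a::complex_normed_vector"
  shows "\<exists>\<phi> :: 'a \<Rightarrow> complex. bounded_clinear \<phi> \<and> (\<forall>x. norm (\<phi> x) \<le> 2 * norm x) \<and> norm x0 \<le> norm (\<phi> x0)"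
proof -
  obtain f :: "'a \<Rightarrow> real" where f: "linear f" "\<And>x. f x \<le> norm x" "norm x0 \<le> f x0"
    using real_norming_functional[of x0] by blast
  define \<phi> where "\<phi> = (\<lambda>x. Complex (f x) (- f (\<i> *\<^sub>C x)))"
  have add: "f (x + y) = f x + f y" for x y using f(1) by (rule linear_add)
  have sc: "f (complex_of_real c *\<^sub>C x) = c * f x" for c x
    using linear_scale[OF f(1), of c x] by (simp add: scaleR_scaleC)
  have fle: "\<bar>f x\<bar> \<le> norm x" for x
    using f(2)[of x] f(2)[of "- x"] linear_neg[OF f(1), of x] by auto
  have bnd: "norm (\<phi> x) \<le> 2 * norm x" for x
    using cmod_le[of "\<phi> x"] fle[of x] fle[of "\<i> *\<^sub>C x"] by (simp add: \<phi>_def norm_scaleC)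
  have scC: "f (c *\<^sub>C x) = Re c * f x + Im c * f (\<i> *\<^sub>C x)" for c x
  proof -
    have "c *\<^sub>C x = complex_of_real (Re c) *\<^sub>C x + complex_of_real (Im c) *\<^sub>C \<i> *\<^sub>C x"
      by (metis complex_eq mult.commute scaleC_add_left scaleC_scaleC)
    then show ?thesis by (simp only: add sc)
  qed
  have "Vector_Spaces.linear scaleC scaleC \<phi>"
  proof (unfold_locales)
    show "\<phi> (x + y) = \<phi> x + \<phi> y" for x y
      by (simp add: \<phi>_def scaleC_add_right add complex_eq_iff)
    show "\<phi> (c *\<^sub>C x) = c *\<^sub>C \<phi> x" for c x
    proof -
      have "f (\<i> *\<^sub>C c *\<^sub>C x) = Re (\<i> * c) * f x + Im (\<i> * c) * f (\<i> *\<^sub>C x)"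
        unfolding scaleC_scaleC by (rule scC)
      then show ?thesis using scC[of c x]
        by (simp add: \<phi>_def complex_eq_iff scaleC_complex_def algebra_simps)
    qed
  qed
  moreover have "norm x0 \<le> norm (\<phi> x0)"
    using f(3) complex_Re_le_cmod[of "\<phi> x0"] by (simp add: \<phi>_def)
  moreover have "\<exists>K. \<forall>x. norm (\<phi> x) \<le> norm x * K"
    using bnd by (metis mult.commute)
  ultimately show ?thesis
    using bnd by (intro exI[of _ \<phi>]) (simp add: bounded_clinear_def)
qed

section \<open>The resolvent near an isolated point of the spectrum\<close>

lemma bounded_clinear_add: "bounded_clinear T \<Longrightarrow> T (x + y) = T x + T y"
  by (rule linear_add[OF bounded_linear.linear[OF bounded_clinear_imp_bounded_linear]])

lemma bounded_clinear_diff: "bounded_clinear T \<Longrightarrow> T (x - y) = T x - T y"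
  by (rule linear_diff[OF bounded_linear.linear[OF bounded_clinear_imp_bounded_linear]])

lemma bounded_clinear_scaleC: "bounded_clinear T \<Longrightarrow> T (c *\<^sub>C x) = c *\<^sub>C T x"
proof -
  assume "bounded_clinear T"
  then interpret Vector_Spaces.linear scaleC scaleC T by (simp add: bounded_clinear_def)
  show ?thesis by (rule scale)
qed

lemma bounded_clinearI:
  assumes "\<And>x y. T (x + y) = T x + T y" "\<And>c x. T (c *\<^sub>C x) = c *\<^sub>C T x"
    "\<And>x. norm (T x) \<le> K * norm x"
  shows "bounded_clinear T"
proof -
  have "Vector_Spaces.linear scaleC scaleC T"
    using assms by unfold_locales auto
  then show ?thesis
    using assms(3) by (auto simp: bounded_clinear_def mult.commute)
qed

lemma bounded_clinear_bound:
  assumes "bounded_clinear T"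
  obtains K where "K > 0" "\<And>x. norm (T x) \<le> K * norm x"
  using bounded_linear.pos_bounded[OF bounded_clinear_imp_bounded_linear[OF assms]]
  by (metis mult.commute)

text \<open>
  The inverse of \<open>T - z\<close>, so the negative of the usual \<open>(z - T)\<inverse>\<close>; the choice is meaningful only off
  the spectrum.
\<close>

definition resolvent :: "('a::complex_normed_vector \<Rightarrow> 'a) \<Rightarrow> complex \<Rightarrow> 'a \<Rightarrow> 'a"
  where "resolvent T z = (SOME S. bounded_clinear S \<and>
    (\<lambda>x. T x - z *\<^sub>C x) \<circ> S = id \<and> S \<circ> (\<lambda>x. T x - z *\<^sub>C x) = id)"

lemma
  assumes T: "bounded_clinear T" and z: "z \<notin> spectrum T"
  shows bounded_clinear_resolvent: "bounded_clinear (resolvent T z)"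
    and resolvent_right: "T (resolvent T z x) = x + z *\<^sub>C resolvent T z x"
    and resolvent_left: "resolvent T z (T x) = x + z *\<^sub>C resolvent T z x"
proof -
  have "\<exists>S. bounded_clinear S \<and> (\<lambda>x. T x - z *\<^sub>C x) \<circ> S = id \<and> S \<circ> (\<lambda>x. T x - z *\<^sub>C x) = id"
    using z unfolding spectrum_def by blast
  from someI_ex[OF this] have R: "bounded_clinear (resolvent T z)"
      "(\<lambda>x. T x - z *\<^sub>C x) \<circ> resolvent T z = id" "resolvent T z \<circ> (\<lambda>x. T x - z *\<^sub>C x) = id"
    unfolding resolvent_def by blast+
  show "bounded_clinear (resolvent T z)" by fact
  show "T (resolvent T z x) = x + z *\<^sub>C resolvent T z x"
    using fun_cong[OF R(2), of x] by (simp add: algebra_simps)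
  show "resolvent T z (T x) = x + z *\<^sub>C resolvent T z x"
    using fun_cong[OF R(3), of x] R(1)
    by (simp add: bounded_clinear_diff bounded_clinear_scaleC algebra_simps)
qed

lemma resolvent_identity:
  assumes T: "bounded_clinear T" and z: "z \<notin> spectrum T" and w: "w \<notin> spectrum T"
  shows "resolvent T z x - resolvent T w x = (z - w) *\<^sub>C resolvent T z (resolvent T w x)"
proof -
  let ?y = "resolvent T w x"
  note R = bounded_clinear_resolvent[OF T z]
  have "resolvent T z x = resolvent T z (T ?y - w *\<^sub>C ?y)"
    using resolvent_right[OF T w, of x] by simp
  also have "\<dots> = ?y + z *\<^sub>C resolvent T z ?y - w *\<^sub>C resolvent T z ?y"
    by (simp add: bounded_clinear_diff[OF R] bounded_clinear_scaleC[OF R] resolvent_left[OF T z])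
  finally show ?thesis by (simp add: complex_vector.scale_left_diff_distrib)
qed

text \<open>
  The resolvent identity expresses \<open>R z y\<close> by \<open>R w y\<close> and \<open>(w - z) R w (R z y)\<close>, and for \<open>z\<close> close to
  \<open>w\<close> the last term has at most half the norm of \<open>R z y\<close>.
\<close>

lemma resolvent_locally_bounded:
  assumes T: "bounded_clinear T" and w: "w \<notin> spectrum T"
  shows "\<exists>M>0. \<exists>d>0. \<forall>z. z \<notin> spectrum T \<and> dist w z < d \<longrightarrow> (\<forall>y. norm (resolvent T z y) \<le> M * norm y)"
proof -
  obtain M where M: "M > 0" "\<And>y. norm (resolvent T w y) \<le> M * norm y"
    using bounded_clinear_bound[OF bounded_clinear_resolvent[OF T w]] by blast
  have "norm (resolvent T z y) \<le> 2 * M * norm y"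
    if z: "z \<notin> spectrum T" "dist w z < 1 / (2 * M)" for z y
  proof -
    let ?u = "resolvent T z y"
    have "?u = resolvent T w y - (w - z) *\<^sub>C resolvent T w ?u"
      using resolvent_identity[OF T w, of z y] z by (simp add: algebra_simps)
    then have "norm ?u \<le> norm (resolvent T w y) + norm ((w - z) *\<^sub>C resolvent T w ?u)"
      by (metis norm_triangle_ineq4)
    also have "\<dots> = norm (resolvent T w y) + dist w z * norm (resolvent T w ?u)"
      by (simp add: norm_scaleC dist_norm)
    also have "\<dots> \<le> M * norm y + (1 / (2 * M)) * (M * norm ?u)"
      using M z by (intro add_mono mult_mono) auto
    also have "\<dots> = M * norm y + norm ?u / 2" using M by simp
    finally show ?thesis by simp
  qed
  then have "\<exists>d>0. \<forall>z. z \<notin> spectrum T \<and> dist w z < d \<longrightarrow> (\<forall>y. norm (resolvent T z y) \<le> 2 * M * norm y)"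
    using M by (intro exI[of _ "1 / (2 * M)"]) auto
  then show ?thesis
    using M by (intro exI[of _ "2 * M"]) auto
qed

lemma resolvent_bounded_on_compact:
  assumes T: "bounded_clinear T" and K: "compact K" "K \<inter> spectrum T = {}"
  shows "\<exists>M>0. \<forall>z\<in>K. \<forall>y. norm (resolvent T z y) \<le> M * norm y"
proof -
  have "\<forall>w\<in>K. \<exists>M d. M > 0 \<and> d > 0 \<and>
      (\<forall>z. z \<notin> spectrum T \<and> dist w z < d \<longrightarrow> (\<forall>y. norm (resolvent T z y) \<le> M * norm y))"
    using resolvent_locally_bounded[OF T] K(2) by (metis disjoint_iff)
  then obtain M d where Md: "\<And>w. w \<in> K \<Longrightarrow> M w > 0 \<and> d w > 0 \<and>
      (\<forall>z. z \<notin> spectrum T \<and> dist w z < d w \<longrightarrow> (\<forall>y. norm (resolvent T z y) \<le> M w * norm y))"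
    by metis
  have "K \<subseteq> (\<Union>w\<in>K. ball w (d w))"
    using Md by fastforce
  then obtain F where F: "F \<subseteq> K" "finite F" "K \<subseteq> (\<Union>w\<in>F. ball w (d w))"
    using compactE_image[OF K(1), of K "\<lambda>w. ball w (d w)"] by auto
  define B where "B = 1 + (\<Sum>w\<in>F. M w)"
  show ?thesis
  proof (intro exI[of _ B] conjI ballI allI)
    show "B > 0" unfolding B_def using Md F(1) by (intro add_pos_nonneg sum_nonneg) (auto intro: less_imp_le)
    fix z y assume z: "z \<in> K"
    then obtain w where w: "w \<in> F" "dist w z < d w" using F(3) by auto
    have "norm (resolvent T z y) \<le> M w * norm y"
      using Md[of w] w F(1) z K(2) by auto
    also have "M w \<le> (\<Sum>w\<in>F. M w)"
      using Md F w by (intro member_le_sum) (auto intro: less_imp_le)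
    then have "M w * norm y \<le> B * norm y" by (intro mult_right_mono) (auto simp: B_def)
    finally show "norm (resolvent T z y) \<le> B * norm y" .
  qed
qed

lemma tendsto_resolvent:
  assumes T: "bounded_clinear T" and V: "open V" "V \<inter> spectrum T = {}" and w: "w \<in> V"
  shows "((\<lambda>z. resolvent T z y) \<longlongrightarrow> resolvent T w y) (at w)"
proof -
  have ws: "w \<notin> spectrum T" using V w by auto
  obtain M d where M: "M > 0" "d > 0"
    "\<And>z y. z \<notin> spectrum T \<Longrightarrow> dist w z < d \<Longrightarrow> norm (resolvent T z y) \<le> M * norm y"
    using resolvent_locally_bounded[OF T ws] by blast
  have "eventually (\<lambda>z. z \<in> V \<inter> ball w d) (nhds w)"
    using V w M by (intro eventually_nhds_in_open) auto
  then have ev: "eventually (\<lambda>z. z \<in> V \<inter> ball w d) (at w)"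
    by (simp add: eventually_at_filter eventually_mono)
  have "((\<lambda>z. resolvent T z y - resolvent T w y) \<longlongrightarrow> 0) (at w)"
  proof (rule Lim_null_comparison)
    show "eventually (\<lambda>z. norm (resolvent T z y - resolvent T w y)
        \<le> norm (z - w) * (M * norm (resolvent T w y))) (at w)"
      using ev
    proof eventually_elim
      case (elim z)
      then have z: "z \<notin> spectrum T" "dist w z < d" using V by auto
      then show ?case
        using M(3)[of z "resolvent T w y"]
        by (auto simp: resolvent_identity[OF T z(1) ws] norm_scaleC intro: mult_left_mono)
    qed
    show "((\<lambda>z. norm (z - w) * (M * norm (resolvent T w y))) \<longlongrightarrow> 0) (at w)"
      by (auto intro!: tendsto_eq_intros)
  qed
  then show ?thesis by (rule Lim_null[THEN iffD2])
qed

lemma holomorphic_resolvent: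
  fixes \<phi> :: "'a::complex_normed_vector \<Rightarrow> complex"
  assumes T: "bounded_clinear T" and V: "open V" "V \<inter> spectrum T = {}" and \<phi>: "bounded_clinear \<phi>"
  shows "(\<lambda>z. \<phi> (resolvent T z x)) holomorphic_on V"
proof -
  have "((\<lambda>z. \<phi> (resolvent T z x)) has_field_derivative \<phi> (resolvent T w (resolvent T w x))) (at w)"
    if w: "w \<in> V" for w
    unfolding has_field_derivative_iff
  proof (rule Lim_transform_eventually)
    show "((\<lambda>z. \<phi> (resolvent T z (resolvent T w x))) \<longlongrightarrow> \<phi> (resolvent T w (resolvent T w x))) (at w)"
      by (intro bounded_linear.tendsto[OF bounded_clinear_imp_bounded_linear[OF \<phi>]]
          tendsto_resolvent[OF T V w])
    have "eventually (\<lambda>z. z \<in> V) (nhds w)"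
      using V w by (intro eventually_nhds_in_open) auto
    then show "eventually (\<lambda>z. \<phi> (resolvent T z (resolvent T w x)) =
        (\<phi> (resolvent T z x) - \<phi> (resolvent T w x)) / (z - w)) (at w)"
      unfolding eventually_at_filter
    proof eventually_elim
      case (elim z)
      show ?case
      proof (intro impI)
        assume "z \<noteq> w"
        have zw: "z \<notin> spectrum T" "w \<notin> spectrum T" using elim V w by auto
        have "\<phi> (resolvent T z x) - \<phi> (resolvent T w x) = (z - w) * \<phi> (resolvent T z (resolvent T w x))"
          unfolding bounded_clinear_diff[OF \<phi>, symmetric] resolvent_identity[OF T zw]
            bounded_clinear_scaleC[OF \<phi>] by (simp add: scaleC_complex_def)
        then show "\<phi> (resolvent T z (resolvent T w x)) =
            (\<phi> (resolvent T z x) - \<phi> (resolvent T w x)) / (z - w)"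
          using \<open>z \<noteq> w\<close> by simp
      qed
    qed
  qed
  then show ?thesis
    using V(1) by (auto simp: holomorphic_on_open)
qed

text \<open>
  By the resolvent identity, bounded resolvents at a convergent sequence of points form a Cauchy
  sequence. Their pointwise limit inverts \<open>T - l\<close>.
\<close>

lemma not_in_spectrum_if_resolvent_bounded:
  fixes T :: "'a::complex_banach \<Rightarrow> 'a"
  assumes T: "bounded_clinear T" and w: "\<And>n. w n \<notin> spectrum T" "w \<longlonglongrightarrow> l"
    and K: "\<And>n y. norm (resolvent T (w n) y) \<le> K * norm y"
  shows "l \<notin> spectrum T"
proof -
  let ?R = "\<lambda>n. resolvent T (w n)"
  have K0: "0 \<le> max K 0" "\<And>n y. norm (?R n y) \<le> max K 0 * norm y"
    by (auto intro: order_trans[OF K mult_right_mono])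
  have "\<exists>S. (\<lambda>n. ?R n x) \<longlonglongrightarrow> S" for x
  proof -
    define D where "D = max K 0 * (max K 0 * norm x)"
    have D: "norm (?R m x - ?R n x) \<le> dist (w m) (w n) * D" for m n
    proof -
      have "norm (?R m (?R n x)) \<le> max K 0 * norm (?R n x)" by (rule K0)
      also have "\<dots> \<le> D" unfolding D_def using K0 by (intro mult_left_mono) auto
      finally show ?thesis
        by (auto simp: resolvent_identity[OF T w(1) w(1)] norm_scaleC dist_norm intro: mult_left_mono)
    qed
    have D0: "D \<ge> 0" by (auto simp: D_def)
    have "Cauchy (\<lambda>n. ?R n x)"
    proof (rule metric_CauchyI)
      fix \<epsilon> :: real assume "\<epsilon> > 0"
      then have "\<epsilon> / (D + 1) > 0" using D0 by simp
      then obtain N where N: "\<And>m n. m \<ge> N \<Longrightarrow> n \<ge> N \<Longrightarrow> dist (w m) (w n) < \<epsilon> / (D + 1)"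
        using LIMSEQ_imp_Cauchy[OF w(2)] unfolding Cauchy_def by metis
      have "dist (?R m x) (?R n x) < \<epsilon>" if "m \<ge> N" "n \<ge> N" for m n
      proof -
        have "dist (?R m x) (?R n x) \<le> dist (w m) (w n) * D" using D by (simp add: dist_norm)
        also have "\<dots> \<le> dist (w m) (w n) * (D + 1)" by (intro mult_left_mono) auto
        also have "\<dots> < \<epsilon>" using N[OF that] D0 by (simp add: field_simps)
        finally show ?thesis .
      qed
      then show "\<exists>M. \<forall>m\<ge>M. \<forall>n\<ge>M. dist (?R m x) (?R n x) < \<epsilon>" by blast
    qed
    then show ?thesis by (simp add: Cauchy_convergent_iff convergent_def)
  qed
  then obtain S where S: "\<And>x. (\<lambda>n. ?R n x) \<longlonglongrightarrow> S x" by metis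
  note R = bounded_clinear_resolvent[OF T w(1)]
  have blC: "bounded_linear (\<lambda>x::'a. c *\<^sub>C x)" for c
    by (rule bounded_linear_intro[where K = "cmod c"])
      (simp_all add: scaleC_add_right norm_scaleC scaleR_scaleC scaleC_scaleC mult.commute)
  have bS: "bounded_clinear S"
  proof (rule bounded_clinearI)
    show "S (x + y) = S x + S y" for x y
      using S[of "x + y"] tendsto_add[OF S[of x] S[of y]]
      by (simp add: bounded_clinear_add[OF R] LIMSEQ_unique)
    show "S (c *\<^sub>C x) = c *\<^sub>C S x" for c x
      using S[of "c *\<^sub>C x"] bounded_linear.tendsto[OF blC[of c] S[of x]]
      by (simp add: bounded_clinear_scaleC[OF R] LIMSEQ_unique)
    show "norm (S x) \<le> max K 0 * norm x" for x
      using K0(2) by (intro LIMSEQ_le_const2[OF tendsto_norm[OF S[of x]]]) auto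
  qed
  have null: "(\<lambda>n. (w n - l) *\<^sub>C ?R n x) \<longlonglongrightarrow> 0" for x
  proof (rule Lim_null_comparison)
    show "eventually (\<lambda>n. norm ((w n - l) *\<^sub>C ?R n x) \<le> norm (w n - l) * (max K 0 * norm x)) sequentially"
      using K0 by (auto simp: norm_scaleC intro!: always_eventually mult_left_mono)
    show "(\<lambda>n. norm (w n - l) * (max K 0 * norm x)) \<longlonglongrightarrow> 0"
      using w(2) by (auto intro!: tendsto_eq_intros simp: LIM_zero_iff tendsto_norm_zero)
  qed
  have right: "T (S x) - l *\<^sub>C S x = x" for x
  proof (rule LIMSEQ_unique)
    show "(\<lambda>n. T (?R n x) - l *\<^sub>C ?R n x) \<longlonglongrightarrow> T (S x) - l *\<^sub>C S x"
      by (intro tendsto_diff bounded_linear.tendsto[OF blC] S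
          bounded_linear.tendsto[OF bounded_clinear_imp_bounded_linear[OF T]])
    have "(\<lambda>n. x + (w n - l) *\<^sub>C ?R n x) \<longlonglongrightarrow> x + 0" by (intro tendsto_intros null)
    then show "(\<lambda>n. T (?R n x) - l *\<^sub>C ?R n x) \<longlonglongrightarrow> x"
      by (simp add: resolvent_right[OF T w(1)] complex_vector.scale_left_diff_distrib algebra_simps)
  qed
  have left: "S (T x - l *\<^sub>C x) = x" for x
  proof (rule LIMSEQ_unique)
    show "(\<lambda>n. ?R n (T x - l *\<^sub>C x)) \<longlonglongrightarrow> S (T x - l *\<^sub>C x)" by (rule S)
    have "(\<lambda>n. x + (w n - l) *\<^sub>C ?R n x) \<longlonglongrightarrow> x + 0" by (intro tendsto_intros null)
    then show "(\<lambda>n. ?R n (T x - l *\<^sub>C x)) \<longlonglongrightarrow> x"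
      by (simp add: bounded_clinear_diff[OF R] bounded_clinear_scaleC[OF R] resolvent_left[OF T w(1)]
          complex_vector.scale_left_diff_distrib algebra_simps)
  qed
  show ?thesis
    using bS right left by (auto simp: spectrum_def fun_eq_iff)
qed

section \<open>The spectral functionals of an isolated point\<close>

locale punctured_disc_resolvent =
  fixes T :: "'a::complex_banach \<Rightarrow> 'a" and l :: complex and r e :: real
  assumes T: "bounded_clinear T" and e: "0 < e" "e < r"
    and disc: "(ball l r - {l}) \<inter> spectrum T = {}"
begin

text \<open>
  Up to the factor \<open>-2 \<pi> \<i>\<close>, \<open>moment \<phi> n\<close> is \<open>x \<mapsto> \<phi> (T^n P x)\<close>, where \<open>P\<close> is the Riesz projection
  belonging to \<open>{l}\<close>. Composing with \<open>\<phi>\<close> first keeps all integrals scalar.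
\<close>

definition moment :: "('a \<Rightarrow> complex) \<Rightarrow> nat \<Rightarrow> 'a \<Rightarrow> complex"
  where "moment \<phi> n x = contour_integral (circlepath l e) (\<lambda>z. z ^ n * \<phi> (resolvent T z x))"

lemma sphere_subset: "sphere l e \<subseteq> ball l r - {l}"
  using e by auto

lemma sphere_not_spectrum: "z \<in> sphere l e \<Longrightarrow> z \<notin> spectrum T"
  using sphere_subset disc by blast

lemma holomorphic_disc:
  assumes "bounded_clinear \<phi>"
  shows "(\<lambda>z. \<phi> (resolvent T z x)) holomorphic_on ball l r - {l}"
  using disc assms by (intro holomorphic_resolvent[OF T]) auto

lemma continuous_sphere:
  fixes \<phi> :: "'a \<Rightarrow> complex"
  assumes "bounded_clinear \<phi>"
  shows "continuous_on (sphere l e) (\<lambda>z. \<phi> (resolvent T z x))"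
  using holomorphic_on_imp_continuous_on[OF holomorphic_disc[OF assms]] sphere_subset
  by (rule continuous_on_subset)

lemma integrable_circle:
  "continuous_on (sphere l e) f \<Longrightarrow> f contour_integrable_on circlepath l e"
  using e by (intro contour_integrable_continuous_circlepath) auto

lemma integrable_moment:
  assumes "bounded_clinear \<phi>"
  shows "(\<lambda>z. z ^ n * \<phi> (resolvent T z x)) contour_integrable_on circlepath l e"
  by (intro integrable_circle continuous_intros continuous_sphere[OF assms])

lemma moment_bound:
  assumes \<phi>: "bounded_clinear \<phi>"
  shows "\<exists>C\<ge>0. \<forall>n x. norm (moment \<phi> n x) \<le> C * (norm l + e) ^ n * norm x"
proof -
  obtain K where K: "K > 0" "\<And>x. norm (\<phi> x) \<le> K * norm x"
    using bounded_clinear_bound[OF \<phi>] by blast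
  obtain M where M: "M > 0" "\<And>z y. z \<in> sphere l e \<Longrightarrow> norm (resolvent T z y) \<le> M * norm y"
    using resolvent_bounded_on_compact[OF T compact_sphere, of l e] sphere_not_spectrum by blast
  have "norm (moment \<phi> n x) \<le> ((norm l + e) ^ n * (K * (M * norm x))) * (2 * pi * e)" for n x
  proof (rule has_contour_integral_bound_circlepath)
    show "((\<lambda>z. z ^ n * \<phi> (resolvent T z x)) has_contour_integral moment \<phi> n x) (circlepath l e)"
      unfolding moment_def by (intro has_contour_integral_integral integrable_moment \<phi>)
    fix z assume z: "norm (z - l) = e"
    have "norm z \<le> norm l + e" using norm_triangle_sub[of z l] z by simp
    moreover have "norm (\<phi> (resolvent T z x)) \<le> K * (M * norm x)"
      using K M(2)[of z x] z
      by (auto intro!: order_trans[OF K(2)] simp: dist_norm norm_minus_commute)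
    ultimately show "norm (z ^ n * \<phi> (resolvent T z x)) \<le> (norm l + e) ^ n * (K * (M * norm x))"
      unfolding norm_mult norm_power by (intro mult_mono power_mono) (use e in auto)
  qed (use e K M in auto)
  then have "norm (moment \<phi> n x) \<le> (K * M * (2 * pi * e)) * (norm l + e) ^ n * norm x" for n x
    by (simp add: mult_ac)
  then show ?thesis using K M e by (intro exI[of _ "K * M * (2 * pi * e)"]) auto
qed

lemma bounded_clinear_moment:
  assumes \<phi>: "bounded_clinear \<phi>"
  shows "bounded_clinear (moment \<phi> n)"
proof -
  obtain C where C: "\<And>n x. norm (moment \<phi> n x) \<le> C * (norm l + e) ^ n * norm x"
    using moment_bound[OF \<phi>] by blast
  have R: "bounded_clinear (resolvent T z)" if "z \<in> sphere l e" for z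
    using bounded_clinear_resolvent[OF T sphere_not_spectrum[OF that]] .
  have img: "path_image (circlepath l e) = sphere l e" using e by simp
  show ?thesis
  proof (rule bounded_clinearI)
    show "moment \<phi> n (x + y) = moment \<phi> n x + moment \<phi> n y" for x y
    proof -
      have "moment \<phi> n (x + y) = contour_integral (circlepath l e)
          (\<lambda>z. z ^ n * \<phi> (resolvent T z x) + z ^ n * \<phi> (resolvent T z y))"
        unfolding moment_def
        by (intro contour_integral_eq, unfold img)
          (simp only: bounded_clinear_add[OF R] bounded_clinear_add[OF \<phi>] distrib_left)
      also have "\<dots> = moment \<phi> n x + moment \<phi> n y"
        unfolding moment_def by (intro contour_integral_add integrable_moment \<phi>)
      finally show ?thesis .
    qed
    show "moment \<phi> n (c *\<^sub>C x) = c *\<^sub>C moment \<phi> n x" for c x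
    proof -
      have "moment \<phi> n (c *\<^sub>C x) = contour_integral (circlepath l e)
          (\<lambda>z. c * (z ^ n * \<phi> (resolvent T z x)))"
        unfolding moment_def
        by (intro contour_integral_eq, unfold img)
          (simp only: bounded_clinear_scaleC[OF R] bounded_clinear_scaleC[OF \<phi>] scaleC_complex_def mult_ac)
      also have "\<dots> = c * moment \<phi> n x"
        unfolding moment_def by (intro contour_integral_lmul integrable_moment \<phi>)
      finally show ?thesis by (simp add: scaleC_complex_def)
    qed
  qed (rule C)
qed

text \<open>
  \<open>R z (T x) = x + z R z x\<close>, and the contribution of \<open>x\<close> is the integral of a polynomial over a closed
  curve.
\<close>

lemma moment_shift:
  assumes \<phi>: "bounded_clinear \<phi>"
  shows "moment \<phi> n (T x) = moment \<phi> (Suc n) x"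
proof -
  have zero: "((\<lambda>z. z ^ n * \<phi> x) has_contour_integral 0) (circlepath l e)"
    by (rule Cauchy_theorem_convex_simple[of _ UNIV]) (auto intro!: holomorphic_intros)
  have "((\<lambda>z. z ^ n * \<phi> x + z ^ Suc n * \<phi> (resolvent T z x)) has_contour_integral
      0 + moment \<phi> (Suc n) x) (circlepath l e)"
    unfolding moment_def
    by (intro has_contour_integral_add zero has_contour_integral_integral integrable_moment \<phi>)
  then have "((\<lambda>z. z ^ n * \<phi> (resolvent T z (T x))) has_contour_integral
      0 + moment \<phi> (Suc n) x) (circlepath l e)"
  proof (rule has_contour_integral_eq)
    fix z assume "z \<in> path_image (circlepath l e)"
    then have "z \<notin> spectrum T" using sphere_not_spectrum e by simp
    then show "z ^ n * \<phi> x + z ^ Suc n * \<phi> (resolvent T z x) = z ^ n * \<phi> (resolvent T z (T x))"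
      by (simp add: resolvent_left[OF T] bounded_clinear_add[OF \<phi>] bounded_clinear_scaleC[OF \<phi>]
          scaleC_complex_def algebra_simps)
  qed
  then show ?thesis unfolding moment_def by (simp add: contour_integral_unique)
qed

lemma moment_iterate:
  assumes \<phi>: "bounded_clinear \<phi>"
  shows "moment \<phi> m ((T ^^ n) x) = moment \<phi> (m + n) x"
proof (induction n arbitrary: m)
  case (Suc n)
  then show ?case using moment_shift[OF \<phi>, of m "(T ^^ n) x"] by simp
qed auto

text \<open>
  Suppose that all moments of order \<open>0\<close> vanish. Applied to the vector \<open>R w x\<close>, with \<open>w\<close> inside the circle,
  the resolvent identity turns this into Cauchy's formula
  \<open>2 \<pi> \<i> \<phi> (R w x) = \<integral> \<phi> (R z x) / (z - w) dz\<close>. It bounds \<open>R w\<close> near \<open>l\<close> by the values of \<open>R\<close>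
  on the circle, so \<open>l\<close> is not in the spectrum.
\<close>

lemma moment_nonzero:
  assumes l: "l \<in> spectrum T"
  shows "\<exists>\<phi> x. bounded_clinear \<phi> \<and> moment \<phi> 0 x \<noteq> 0"
proof (rule ccontr)
  assume "\<not> ?thesis"
  then have zero: "\<And>\<phi> x. bounded_clinear \<phi> \<Longrightarrow> moment \<phi> 0 x = 0" by blast
  obtain M where M: "M > 0" "\<And>z y. z \<in> sphere l e \<Longrightarrow> norm (resolvent T z y) \<le> M * norm y"
    using resolvent_bounded_on_compact[OF T compact_sphere, of l e] sphere_not_spectrum by blast
  have bound: "norm (resolvent T w x) \<le> 4 * M * norm x" if w: "w \<in> ball l (e / 2) - {l}" for w x
  proof -
    have "w \<in> ball l r - {l}" using w e by auto
    then have ws: "w \<notin> spectrum T" using disc by blast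
    let ?y = "resolvent T w x"
    obtain \<phi> :: "'a \<Rightarrow> complex" where \<phi>: "bounded_clinear \<phi>" "\<And>x. norm (\<phi> x) \<le> 2 * norm x"
        "norm ?y \<le> norm (\<phi> ?y)"
      using complex_norming_functional[of ?y] by blast
    have far: "norm (z - w) \<ge> e / 2" if "norm (z - l) = e" for z
      using w that norm_triangle_ineq[of "z - w" "w - l"] by (simp add: dist_norm norm_minus_commute)
    have "((\<lambda>z. z ^ 0 * \<phi> (resolvent T z ?y)) has_contour_integral 0) (circlepath l e)"
      using has_contour_integral_integral[OF integrable_moment[OF \<phi>(1), of 0 ?y]]
        zero[OF \<phi>(1), of ?y] by (simp add: moment_def)
    moreover have "((\<lambda>z. \<phi> ?y / (z - w)) has_contour_integral 2 * of_real pi * \<i> * \<phi> ?y) (circlepath l e)"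
      using w e by (intro Cauchy_integral_circlepath_simple[where f = "\<lambda>_. \<phi> ?y"]) (auto simp: dist_norm norm_minus_commute)
    ultimately have "((\<lambda>z. z ^ 0 * \<phi> (resolvent T z ?y) + \<phi> ?y / (z - w)) has_contour_integral
        0 + 2 * of_real pi * \<i> * \<phi> ?y) (circlepath l e)"
      by (rule has_contour_integral_add)
    then have "((\<lambda>z. \<phi> (resolvent T z x) / (z - w)) has_contour_integral
        0 + 2 * of_real pi * \<i> * \<phi> ?y) (circlepath l e)"
    proof (rule has_contour_integral_eq)
      fix z assume "z \<in> path_image (circlepath l e)"
      then have z: "norm (z - l) = e" "z \<notin> spectrum T"
        using sphere_not_spectrum e by (auto simp: dist_norm norm_minus_commute)
      then have "z \<noteq> w" using far[of z] e by auto
      have "\<phi> (resolvent T z x) - \<phi> ?y = (z - w) * \<phi> (resolvent T z ?y)"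
        unfolding bounded_clinear_diff[OF \<phi>(1), symmetric] resolvent_identity[OF T z(2) ws]
          bounded_clinear_scaleC[OF \<phi>(1)] by (simp add: scaleC_complex_def)
      then show "z ^ 0 * \<phi> (resolvent T z ?y) + \<phi> ?y / (z - w) = \<phi> (resolvent T z x) / (z - w)"
        using \<open>z \<noteq> w\<close> by (simp add: field_simps)
    qed
    then have "norm (0 + 2 * of_real pi * \<i> * \<phi> ?y) \<le> (2 * (M * norm x) / (e / 2)) * (2 * pi * e)"
    proof (rule has_contour_integral_bound_circlepath)
      fix z assume z: "norm (z - l) = e"
      then have "norm (\<phi> (resolvent T z x)) \<le> 2 * (M * norm x)"
        using M(2)[of z x] by (intro order_trans[OF \<phi>(2)]) (auto simp: dist_norm norm_minus_commute)
      then show "norm (\<phi> (resolvent T z x) / (z - w)) \<le> 2 * (M * norm x) / (e / 2)"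
        using far[OF z] e M(1) unfolding norm_divide by (intro frac_le) auto
    qed (use e M in auto)
    also have "\<dots> = (2 * pi) * (4 * M * norm x)" using e by (simp add: field_simps)
    finally have "norm (\<phi> ?y) \<le> 4 * M * norm x" by (simp add: norm_mult)
    then show ?thesis using \<phi>(3) by linarith
  qed
  define a where "a n = e / 4 * (1 / real (Suc n))" for n
  define w where "w n = l + complex_of_real (a n)" for n
  have w: "w n \<in> ball l (e / 2) - {l}" for n
  proof -
    have "a n \<le> e / 4 * 1"
      unfolding a_def using e by (intro mult_left_mono) auto
    moreover have "a n > 0" using e by (simp add: a_def)
    moreover have "dist l (w n) = \<bar>a n\<bar>" by (simp add: w_def dist_norm)
    ultimately show ?thesis using e by (auto simp: w_def)
  qed
  have "a \<longlonglongrightarrow> e / 4 * 0"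
    unfolding a_def by (intro tendsto_intros LIMSEQ_Suc[OF lim_1_over_n])
  then have "w \<longlonglongrightarrow> l + complex_of_real 0"
    unfolding w_def by (intro tendsto_intros) simp
  then have "w \<longlonglongrightarrow> l" by simp
  moreover have w_spec: "w n \<notin> spectrum T" for n
  proof -
    have "w n \<in> ball l r - {l}" using w[of n] e by auto
    then show ?thesis using disc by blast
  qed
  ultimately show False
    using not_in_spectrum_if_resolvent_bounded[where w = w, OF T w_spec _ bound[OF w]] l by blast
qed

end

section \<open>Exponential circle integrals around an isolated singularity\<close>

lemma circle_integral_exp_entire:
  assumes e: "e > 0" and L: "continuous_on (sphere l e) L" and h: "continuous_on (sphere l e) h"
  shows "(\<lambda>z. contour_integral (circlepath l e) (\<lambda>s. exp (z * L s) * h s)) holomorphic_on UNIV"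
proof -
  let ?\<gamma> = "circlepath l e"
  let ?d = "\<lambda>t::real. 2 * pi * \<i> * e * exp (2 * of_real pi * \<i> * t)"
  have eq: "contour_integral ?\<gamma> (\<lambda>s. exp (z * L s) * h s) =
      integral (cbox 0 1) (\<lambda>t. exp (z * L (?\<gamma> t)) * h (?\<gamma> t) * ?d t)" for z
    by (simp add: contour_integral_integral vector_derivative_circlepath)
  have \<gamma>: "continuous_on {0..1} ?\<gamma>" using path_circlepath[of l e] by (simp add: path_def)
  have img: "?\<gamma> ` {0..1} \<subseteq> sphere l e"
    using path_image_circlepath[of l e] e by (auto simp: path_image_def)
  have L\<gamma>: "continuous_on {0..1} (\<lambda>t. L (?\<gamma> t))"
    using continuous_on_compose2[OF L \<gamma> img] .
  have h\<gamma>: "continuous_on {0..1} (\<lambda>t. h (?\<gamma> t))"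
    using continuous_on_compose2[OF h \<gamma> img] .
  show ?thesis
    unfolding eq
  proof (rule leibniz_rule_holomorphic)
    show "((\<lambda>z. exp (z * L (?\<gamma> t)) * h (?\<gamma> t) * ?d t) has_field_derivative
        L (?\<gamma> t) * exp (z * L (?\<gamma> t)) * h (?\<gamma> t) * ?d t) (at z within UNIV)" for z t
      by (auto intro!: derivative_eq_intros)
    show "(\<lambda>t. exp (z * L (?\<gamma> t)) * h (?\<gamma> t) * ?d t) integrable_on cbox 0 1" for z
      unfolding cbox_interval
      by (intro integrable_continuous_interval continuous_intros L\<gamma> h\<gamma>)
    have snd: "continuous_on (UNIV \<times> {0..1}) (\<lambda>p::complex \<times> real. f (snd p))"
      if "continuous_on {0..1} f" for f :: "real \<Rightarrow> complex"
      using that by (rule continuous_on_compose2) (auto intro: continuous_intros)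
    show "continuous_on (UNIV \<times> cbox 0 1)
        (\<lambda>(z, t). L (?\<gamma> t) * exp (z * L (?\<gamma> t)) * h (?\<gamma> t) * ?d t)"
      unfolding cbox_interval case_prod_beta
      by (intro continuous_intros snd L\<gamma> h\<gamma>)
  qed auto
qed

text \<open>
  The integral does not change when the circle shrinks to a radius at which
  \<open>norm (Ln (s / l)) \<le> \<eta>\<close>, and then it grows at most like \<open>exp (\<eta> * norm z)\<close>. The condition
  \<open>e < norm l\<close> keeps \<open>s / l\<close> in the right half-plane, away from the branch cut of \<open>Ln\<close>.
\<close>

lemma circle_integral_exp_type_zero:
  assumes h: "h holomorphic_on ball l r - {l}" and e: "0 < e" "e < r" "e < norm l"
  shows "exp_type_zero (\<lambda>z. contour_integral (circlepath l e) (\<lambda>s. exp (z * Ln (s / l)) * h s))"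
  unfolding exp_type_zero_def
proof (intro conjI allI impI)
  let ?U = "ball l (min r (norm l))"
  have l0: "l \<noteq> 0" using e by auto
  have Lhol: "(\<lambda>s. Ln (s / l)) holomorphic_on ?U"
  proof (intro holomorphic_intros)
    fix s assume "s \<in> ?U"
    then have "norm (l - s) < norm l" by (simp add: dist_norm)
    moreover have "norm (1 - s / l) = norm (l - s) / norm l"
      using l0 by (simp add: norm_divide[symmetric] diff_divide_distrib)
    ultimately have "norm (1 - s / l) < 1" using l0 by simp
    then have "Re (s / l) > 0" using complex_Re_le_cmod[of "1 - s / l"] by simp
    then show "s / l \<notin> \<real>\<^sub>\<le>\<^sub>0" by (auto simp: complex_nonpos_Reals_iff)
  qed (use l0 in auto)
  have hU: "h holomorphic_on ?U - {l}" using h by (rule holomorphic_on_subset) auto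
  have sub: "sphere l e' \<subseteq> ?U - {l}" if "0 < e'" "e' \<le> e" for e' using that e by auto
  have Lc: "continuous_on (sphere l e') (\<lambda>s. Ln (s / l))" if "0 < e'" "e' \<le> e" for e'
    using holomorphic_on_imp_continuous_on[OF Lhol] by (rule continuous_on_subset) (use sub[OF that] in blast)
  have hc: "continuous_on (sphere l e') h" if "0 < e'" "e' \<le> e" for e'
    using holomorphic_on_imp_continuous_on[OF hU] by (rule continuous_on_subset) (use sub[OF that] in blast)
  show "(\<lambda>z. contour_integral (circlepath l e) (\<lambda>s. exp (z * Ln (s / l)) * h s)) holomorphic_on UNIV"
    using e by (intro circle_integral_exp_entire Lc hc) auto
  fix \<eta> :: real assume \<eta>: "\<eta> > 0"
  have "continuous (at l) (\<lambda>s. Ln (s / l))"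
    using holomorphic_on_imp_continuous_on[OF Lhol] e l0
    by (auto simp: continuous_on_eq_continuous_at)
  then obtain d where d: "d > 0" "\<And>s. dist s l < d \<Longrightarrow> dist (Ln (s / l)) (Ln (l / l)) < \<eta>"
    using \<eta> unfolding continuous_at_eps_delta by metis
  define e' where "e' = min e (d / 2)"
  have e': "0 < e'" "e' \<le> e" "e' < d" using d e by (auto simp: e'_def)
  have "compact (h ` sphere l e')" by (intro compact_continuous_image hc e' compact_sphere)
  then obtain B where B: "B > 0" "\<And>s. s \<in> sphere l e' \<Longrightarrow> norm (h s) \<le> B"
    using compact_imp_bounded bounded_pos by (metis imageI)
  have "norm (contour_integral (circlepath l e) (\<lambda>s. exp (z * Ln (s / l)) * h s))
      \<le> B * (2 * pi * e') * exp (\<eta> * norm z)" for z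
  proof -
    let ?f = "\<lambda>s. exp (z * Ln (s / l)) * h s"
    have fhol: "?f holomorphic_on ?U - {l}"
      by (intro holomorphic_on_mult holomorphic_on_exp' holomorphic_on_ident hU
          holomorphic_on_subset[OF Lhol]) auto
    have cb: "cball l e \<subseteq> ?U" using e by auto
    note C = contour_integral_circlepath_eq[OF open_ball fhol e'(1,2) cb]
    have "norm (contour_integral (circlepath l e') ?f) \<le> (exp (\<eta> * norm z) * B) * (2 * pi * e')"
    proof (rule has_contour_integral_bound_circlepath)
      show "(?f has_contour_integral contour_integral (circlepath l e') ?f) (circlepath l e')"
        by (rule has_contour_integral_integral[OF C(1)])
      fix s assume s: "norm (s - l) = e'"
      have "norm (Ln (s / l)) \<le> \<eta>" using d(2)[of s] s e' l0 by (simp add: dist_norm)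
      then have "norm (z * Ln (s / l)) \<le> \<eta> * norm z"
        unfolding norm_mult by (subst mult.commute) (intro mult_right_mono, auto)
      then have "norm (exp (z * Ln (s / l))) \<le> exp (\<eta> * norm z)"
        using norm_exp[of "z * Ln (s / l)"] by (meson exp_le_cancel_iff order_trans)
      then show "norm (?f s) \<le> exp (\<eta> * norm z) * B"
        unfolding norm_mult using B s by (intro mult_mono) (auto simp: dist_norm norm_minus_commute)
    qed (use B e' in auto)
    then show ?thesis unfolding C(3) by (simp add: mult_ac)
  qed
  then show "\<exists>C. \<forall>z. norm (contour_integral (circlepath l e) (\<lambda>s. exp (z * Ln (s / l)) * h s))
      \<le> C * exp (\<eta> * norm z)" by blast
qed

section \<open>Sign changes along a frequently hypercyclic orbit\<close>

lemma lower_density_posD: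
  assumes "lower_density A > 0"
  shows "\<exists>c>0. \<exists>N. \<forall>n\<ge>N. c * real n < real (card {m \<in> A. m \<le> n})"
proof -
  obtain c :: ereal where c: "0 < c" "c < lower_density A" using dense[OF assms] by blast
  then obtain c' where c': "c = ereal c'" "c' > 0" by (cases c) auto
  have "eventually (\<lambda>n. c < ereal (real (card {m \<in> A. m \<le> n}) / real n)) sequentially"
    using c(2) unfolding lower_density_def by (rule less_LiminfD)
  then obtain N where N: "\<And>n. n \<ge> N \<Longrightarrow> c' < real (card {m \<in> A. m \<le> n}) / real n"
    unfolding eventually_sequentially c' by auto
  have "c' * real n < real (card {m \<in> A. m \<le> n})" if "n \<ge> max 1 N" for n
    using N[of n] that by (simp add: pos_less_divide_eq)
  then show ?thesis using c'(2) by blast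
qed

text \<open>
  With \<open>u\<close> near \<open>-1\<close> and \<open>v\<close> near \<open>1\<close>, the numbers \<open>\<mu> u\<close> and \<open>\<mu> v\<close> point in nearly opposite directions.
  If \<open>\<mu>\<close> lies in the sector around the real axis, the real parts detect this; otherwise \<open>-\<i> \<mu>\<close> lies
  in that sector.
\<close>

lemma Re_mult_sign:
  fixes \<mu> u v :: complex
  assumes \<mu>: "\<bar>Im \<mu>\<bar> \<le> \<bar>Re \<mu>\<bar>" "Re \<mu> \<noteq> 0" and u: "norm (u + 1) < 1 / 2" and v: "norm (v - 1) < 1 / 2"
  shows "Re (\<mu> * u) * Re (\<mu> * v) < 0"
proof -
  let ?a = "Re \<mu>" and ?b = "Im \<mu>"
  have b: "\<bar>?a * (?b * t)\<bar> \<le> ?a\<^sup>2 / 2" if "\<bar>t\<bar> < 1 / 2" for t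
  proof -
    have "\<bar>?b\<bar> * \<bar>t\<bar> \<le> \<bar>?a\<bar> * (1 / 2)" using \<mu> that by (intro mult_mono) auto
    then have "\<bar>?a\<bar> * (\<bar>?b\<bar> * \<bar>t\<bar>) \<le> \<bar>?a\<bar> * (\<bar>?a\<bar> * (1 / 2))" by (intro mult_left_mono) auto
    then show ?thesis by (simp add: abs_mult power2_eq_square)
  qed
  have a2: "?a\<^sup>2 > 0" using \<mu> by simp
  have "Re u < - 1 / 2" "\<bar>Im u\<bar> < 1 / 2"
    using u abs_Re_le_cmod[of "u + 1"] abs_Im_le_cmod[of "u + 1"] by auto
  moreover have "1 / 2 < Re v" "\<bar>Im v\<bar> < 1 / 2"
    using v abs_Re_le_cmod[of "v - 1"] abs_Im_le_cmod[of "v - 1"] by auto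
  moreover from calculation have "?a\<^sup>2 * Re u < ?a\<^sup>2 * (- 1 / 2)" "?a\<^sup>2 * (1 / 2) < ?a\<^sup>2 * Re v"
    by (intro mult_strict_left_mono a2; simp)+
  ultimately have "?a * Re (\<mu> * u) < 0" "?a * Re (\<mu> * v) > 0"
    using b[of "Im u"] b[of "Im v"] by (auto simp: algebra_simps power2_eq_square)
  then have "(?a * Re (\<mu> * u)) * (?a * Re (\<mu> * v)) < 0" by (rule mult_neg_pos)
  then have "?a\<^sup>2 * (Re (\<mu> * u) * Re (\<mu> * v)) < 0" by (simp add: power2_eq_square mult_ac)
  then show ?thesis using a2 by (simp add: mult_less_0_iff)
qed

text \<open>
  Otherwise \<open>norm (\<psi> (T^n x)) = norm \<mu> ^ n * norm (\<psi> x)\<close> would stay on one side of \<open>norm (\<psi> x)\<close>,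
  although \<open>\<psi>\<close> maps a dense orbit onto a dense set of complex numbers.
\<close>

lemma hypercyclic_no_eigenfunctional:
  fixes T :: "'a::complex_normed_vector \<Rightarrow> 'a" and \<psi> :: "'a \<Rightarrow> complex"
  assumes \<psi>: "bounded_clinear \<psi>" "\<psi> x1 \<noteq> 0"
    and hits: "\<And>U. open U \<Longrightarrow> U \<noteq> {} \<Longrightarrow> \<exists>n. (T ^^ n) x \<in> U"
  shows "\<exists>y. \<psi> (T y) \<noteq> \<mu> * \<psi> y"
proof (rule ccontr)
  assume "\<not> ?thesis"
  then have "\<psi> (T y) = \<mu> * \<psi> y" for y by blast
  then have it: "\<psi> ((T ^^ n) x) = \<mu> ^ n * \<psi> x" for n by (induction n) auto
  have cont: "continuous_on UNIV (\<lambda>y. norm (\<psi> y))"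
    by (intro continuous_intros bounded_linear.continuous_on[OF bounded_clinear_imp_bounded_linear[OF \<psi>(1)]])
  have surj: "\<exists>y. \<psi> y = c" for c
    using \<psi> by (intro exI[of _ "(c / \<psi> x1) *\<^sub>C x1"])
      (simp add: bounded_clinear_scaleC scaleC_complex_def)
  show False
  proof (cases "norm \<mu> \<le> 1 \<or> \<psi> x = 0")
    case True
    have "open {y. norm (\<psi> x) < norm (\<psi> y)}"
      by (intro open_Collect_less cont continuous_on_const)
    moreover obtain y where "\<psi> y = of_real (norm (\<psi> x) + 1)" using surj by blast
    then have "norm (\<psi> y) = norm (\<psi> x) + 1" by (simp only: norm_of_real) simp
    then have "y \<in> {y. norm (\<psi> x) < norm (\<psi> y)}" by simp
    ultimately obtain n where n: "norm (\<psi> x) < norm (\<mu> ^ n * \<psi> x)"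
      using hits[of "{y. norm (\<psi> x) < norm (\<psi> y)}"] it by auto
    have "norm (\<mu> ^ n * \<psi> x) \<le> 1 * norm (\<psi> x)"
    proof (cases "\<psi> x = 0")
      case False
      then show ?thesis
        using True unfolding norm_mult norm_power by (intro mult_right_mono power_le_one) auto
    qed auto
    then show False using n by simp
  next
    case False
    have "open {y. norm (\<psi> y) < norm (\<psi> x)}"
      by (intro open_Collect_less cont continuous_on_const)
    moreover obtain y where "\<psi> y = 0" using surj by blast
    then have "y \<in> {y. norm (\<psi> y) < norm (\<psi> x)}" using False by simp
    ultimately obtain n where n: "norm (\<mu> ^ n * \<psi> x) < norm (\<psi> x)"
      using hits[of "{y. norm (\<psi> y) < norm (\<psi> x)}"] it by auto
    have "1 * norm (\<psi> x) \<le> norm (\<mu> ^ n * \<psi> x)"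
      using False unfolding norm_mult norm_power by (intro mult_right_mono one_le_power) auto
    then show False using n by simp
  qed
qed

text \<open>
  The functionals \<open>\<psi>\<close> and \<open>\<psi> \<circ> T\<close> are linearly independent, so together they map onto pairs of
  complex numbers.
\<close>

lemma interpolating_vector:
  fixes T :: "'a::complex_normed_vector \<Rightarrow> 'a" and \<psi> :: "'a \<Rightarrow> complex"
  assumes T: "bounded_clinear T" and \<psi>: "bounded_clinear \<psi>" "\<psi> x1 \<noteq> 0"
    and no_eig: "\<And>\<mu>. \<exists>y. \<psi> (T y) \<noteq> \<mu> * \<psi> y"
  shows "\<exists>y. \<psi> y = a \<and> \<psi> (T y) = b"
proof -
  define x2 where "x2 = (1 / \<psi> x1) *\<^sub>C x1"
  note lin = bounded_clinear_add[OF \<psi>(1)] bounded_clinear_scaleC[OF \<psi>(1)] bounded_clinear_diff[OF \<psi>(1)]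
    bounded_clinear_add[OF T] bounded_clinear_scaleC[OF T] bounded_clinear_diff[OF T] scaleC_complex_def
  have x2: "\<psi> x2 = 1" using \<psi>(2) by (simp add: x2_def lin)
  obtain y where y: "\<psi> (T y) \<noteq> \<psi> (T x2) * \<psi> y" using no_eig by blast
  define k where "k = y - \<psi> y *\<^sub>C x2"
  have k: "\<psi> k = 0" "\<psi> (T k) \<noteq> 0" using y x2 by (auto simp: k_def lin)
  show ?thesis
    using k x2
    by (intro exI[of _ "a *\<^sub>C x2 + ((b - a * \<psi> (T x2)) / \<psi> (T k)) *\<^sub>C k"]) (simp add: lin)
qed

theorem theorem1p2:
  fixes T :: "'a::complex_banach \<Rightarrow> 'a"
  assumes "bounded_clinear T"
    and "frequently_hypercyclic T"
  shows "\<not> (\<exists>z. z isolated_in spectrum T)"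
proof
  assume "\<exists>z. z isolated_in spectrum T"
  then obtain l r where l: "l \<in> spectrum T" and r: "r > 0" "\<And>y. y \<in> spectrum T \<Longrightarrow> dist l y < r \<Longrightarrow> y = l"
    unfolding isolated_in_dist_Ex_iff by blast
  \<comment> \<open>A radius below \<open>1\<close> makes the powers \<open>z^n\<close> bounded in the case \<open>l = 0\<close>; otherwise a radius
    below \<open>norm l\<close> makes \<open>Ln (s / l)\<close> holomorphic.\<close>
  define e where "e = (if l = 0 then min r 1 else min r (norm l)) / 2"
  interpret punctured_disc_resolvent T l r e
    using r assms(1) by unfold_locales (auto simp: e_def)
  obtain \<phi> x1 where \<phi>: "bounded_clinear \<phi>" and x1: "moment \<phi> 0 x1 \<noteq> 0"
    using moment_nonzero[OF l] by blast
  define \<psi> where "\<psi> = moment \<phi> 0"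
  have \<psi>: "bounded_clinear \<psi>" "\<psi> x1 \<noteq> 0"
    using bounded_clinear_moment[OF \<phi>] x1 by (auto simp: \<psi>_def)
  have contT: "continuous_on UNIV T"
    by (rule bounded_linear.continuous_on[OF bounded_clinear_imp_bounded_linear[OF T]]) (rule continuous_on_id)
  have cont\<psi>: "continuous_on UNIV \<psi>"
    by (rule bounded_linear.continuous_on[OF bounded_clinear_imp_bounded_linear[OF \<psi>(1)]]) (rule continuous_on_id)
  obtain x where x: "\<And>U. open U \<Longrightarrow> U \<noteq> {} \<Longrightarrow> lower_density {n. 1 \<le> n \<and> (T ^^ n) x \<in> U} > 0"
    using assms(2) unfolding frequently_hypercyclic_def by blast
  have hit: "\<exists>n. (T ^^ n) x \<in> U" if "open U" "U \<noteq> {}" for U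
  proof (rule ccontr)
    assume "\<not> ?thesis"
    then have "{n. 1 \<le> n \<and> (T ^^ n) x \<in> U} = {}" by blast
    then have "lower_density {} > 0" using x[OF that] by (simp only:)
    from lower_density_posD[OF this] obtain c N where "c > 0" "\<forall>n\<ge>N. c * real n < 0" by auto
    then have "c * real (max 1 N) < 0" by (metis max.cobounded2)
    then show False using \<open>c > 0\<close> by (simp add: mult_less_0_iff)
  qed
  have no_eig: "\<exists>y. \<psi> (T y) \<noteq> \<mu> * \<psi> y" for \<mu>
    using \<psi> hit by (rule hypercyclic_no_eigenfunctional)
  have interp: "\<exists>y. \<psi> y = a \<and> \<psi> (T y) = b" for a b
    using T \<psi> no_eig by (rule interpolating_vector)
  have orbit: "\<psi> ((T ^^ n) x) = moment \<phi> n x" for n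
    using moment_iterate[OF \<phi>, of 0 n x] by (simp add: \<psi>_def)
  show False
  proof (cases "l = 0")
    case True
    then have e1: "e \<le> 1" by (simp add: e_def)
    obtain C where C: "C \<ge> 0" "\<And>n x. norm (moment \<phi> n x) \<le> C * (norm l + e) ^ n * norm x"
      using moment_bound[OF \<phi>] by blast
    have bnd: "norm (\<psi> ((T ^^ n) x)) \<le> C * norm x" for n
    proof -
      have "C * (norm l + e) ^ n * norm x \<le> C * 1 * norm x"
        using True e e1 C(1) by (intro mult_mono power_le_one) auto
      then show ?thesis using C(2)[of n x] unfolding orbit by simp
    qed
    have "open {y. C * norm x < norm (\<psi> y)}"
      by (intro open_Collect_less continuous_on_norm cont\<psi> continuous_on_const)
    moreover obtain y where "\<psi> y = of_real (C * norm x + 1)" using interp by blast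
    then have "norm (\<psi> y) = C * norm x + 1" using C(1) by (simp only: norm_of_real) simp
    then have "y \<in> {y. C * norm x < norm (\<psi> y)}" by simp
    ultimately obtain n where "C * norm x < norm (\<psi> ((T ^^ n) x))"
      using hit[of "{y. C * norm x < norm (\<psi> y)}"] by auto
    then show False using bnd[of n] by simp
  next
    case False
    have "e = min r (norm l) / 2" "min r (norm l) \<le> norm l" "norm l > 0"
      using False by (simp_all add: e_def)
    then have el: "e < norm l" by linarith
    define f where "f = (\<lambda>z. contour_integral (circlepath l e)
      (\<lambda>s. exp (z * Ln (s / l)) * \<phi> (resolvent T s x)))"
    have f: "exp_type_zero f"
      unfolding f_def
      by (rule circle_integral_exp_type_zero[OF holomorphic_disc[OF \<phi>] e el])
    have f_nat: "f (of_nat n) = \<psi> ((T ^^ n) x) / l ^ n" for n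
    proof -
      have "f (of_nat n) = contour_integral (circlepath l e)
          (\<lambda>s. (1 / l ^ n) * (s ^ n * \<phi> (resolvent T s x)))"
        unfolding f_def
      proof (rule contour_integral_eq)
        fix s assume "s \<in> path_image (circlepath l e)"
        then have "s \<noteq> 0" using e el by auto
        then show "exp (of_nat n * Ln (s / l)) * \<phi> (resolvent T s x) =
            (1 / l ^ n) * (s ^ n * \<phi> (resolvent T s x))"
          using False by (simp add: exp_of_nat_mult power_divide)
      qed
      also have "\<dots> = (1 / l ^ n) * moment \<phi> n x"
        unfolding moment_def by (intro contour_integral_lmul integrable_moment \<phi>)
      finally show ?thesis by (simp add: orbit)
    qed
    have if_zero: "exp_type_zero (\<lambda>z. - \<i> * f z)"
      using f by (auto simp: exp_type_zero_def norm_mult intro!: holomorphic_intros)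
    define U where "U = {y. norm (\<psi> y + 1) < 1 / 2 \<and> norm (\<psi> (T y) / l - 1) < 1 / 2}"
    have "open U"
      unfolding U_def using False
      by (intro open_Collect_conj open_Collect_less continuous_intros cont\<psi>
          continuous_on_compose2[OF cont\<psi> contT]) auto
    moreover obtain y0 where "\<psi> y0 = - 1" "\<psi> (T y0) = l" using interp by blast
    then have "y0 \<in> U" using False by (simp add: U_def)
    ultimately have "lower_density {n. 1 \<le> n \<and> (T ^^ n) x \<in> U} > 0" using x by blast
    then obtain c N where c: "c > 0"
      and N: "\<And>n. n \<ge> N \<Longrightarrow> c * real n < real (card {m \<in> {n. 1 \<le> n \<and> (T ^^ n) x \<in> U}. m \<le> n})"
      using lower_density_posD by blast
    \<comment> \<open>Each visit to \<open>U\<close> is a sign change of the real part of \<open>f\<close> or of \<open>-\<i> f\<close>. Each kind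
      occurs at most \<open>(c / 2) n\<close> times up to \<open>n\<close>, but there are more than \<open>c n\<close> visits.\<close>
    define S where "S g n = {m. Re (g (of_nat m)) * Re (g (of_nat (Suc m))) < 0 \<and> m \<le> n}"
      for g :: "complex \<Rightarrow> complex" and n
    obtain N1 where N1: "\<And>n. n \<ge> N1 \<Longrightarrow> real (card (S f n)) \<le> c / 2 * real n"
      using exp_type_zero_sign_changes[OF f, of "c / 2"] c unfolding S_def by auto
    obtain N2 where N2: "\<And>n. n \<ge> N2 \<Longrightarrow> real (card (S (\<lambda>z. - \<i> * f z) n)) \<le> c / 2 * real n"
      using exp_type_zero_sign_changes[OF if_zero, of "c / 2"] c unfolding S_def by auto
    have sub: "{m \<in> {n. 1 \<le> n \<and> (T ^^ n) x \<in> U}. m \<le> n} \<subseteq> S f n \<union> S (\<lambda>z. - \<i> * f z) n" for n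
    proof
      fix m assume m: "m \<in> {m \<in> {n. 1 \<le> n \<and> (T ^^ n) x \<in> U}. m \<le> n}"
      let ?y = "(T ^^ m) x" and ?\<mu> = "1 / l ^ m"
      have U: "norm (\<psi> ?y + 1) < 1 / 2" "norm (\<psi> (T ?y) / l - 1) < 1 / 2"
        using m by (auto simp: U_def)
      have fm: "f (of_nat m) = ?\<mu> * \<psi> ?y" "f (of_nat (Suc m)) = ?\<mu> * (\<psi> (T ?y) / l)"
        unfolding f_nat by simp_all
      have mn: "m \<le> n" using m by simp
      have "?\<mu> \<noteq> 0" using False by simp
      show "m \<in> S f n \<union> S (\<lambda>z. - \<i> * f z) n"
      proof (cases "\<bar>Im ?\<mu>\<bar> \<le> \<bar>Re ?\<mu>\<bar>")
        case True
        then have "Re ?\<mu> \<noteq> 0" using \<open>?\<mu> \<noteq> 0\<close> by (auto simp: complex_eq_iff simp del: divide_eq_0_iff)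
        then have "m \<in> S f n"
          using Re_mult_sign[OF True _ U] mn unfolding S_def mem_Collect_eq fm by blast
        then show ?thesis by blast
      next
        case False
        moreover have "Re (- \<i> * ?\<mu>) = Im ?\<mu>" "Im (- \<i> * ?\<mu>) = - Re ?\<mu>"
          by (simp_all only: Re_i_times Im_i_times mult_minus_left
              uminus_complex.simps minus_minus)
        ultimately have "\<bar>Im (- \<i> * ?\<mu>)\<bar> \<le> \<bar>Re (- \<i> * ?\<mu>)\<bar>" "Re (- \<i> * ?\<mu>) \<noteq> 0" by linarith+
        from Re_mult_sign[OF this U] have "m \<in> S (\<lambda>z. - \<i> * f z) n"
          using mn unfolding S_def mem_Collect_eq fm mult.assoc by blast
        then show ?thesis by blast
      qed
    qed
    define n where "n = max N (max N1 N2)"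
    have fin: "finite (S g n)" for g by (rule finite_subset[of _ "{..n}"]) (auto simp: S_def)
    have "card {m \<in> {n. 1 \<le> n \<and> (T ^^ n) x \<in> U}. m \<le> n} \<le> card (S f n \<union> S (\<lambda>z. - \<i> * f z) n)"
      by (intro card_mono sub finite_UnI fin)
    also have "\<dots> \<le> card (S f n) + card (S (\<lambda>z. - \<i> * f z) n)" by (rule card_Un_le)
    finally have "real (card {m \<in> {n. 1 \<le> n \<and> (T ^^ n) x \<in> U}. m \<le> n})
        \<le> real (card (S f n)) + real (card (S (\<lambda>z. - \<i> * f z) n))"
      by (simp only: of_nat_add[symmetric] of_nat_le_iff)
    moreover have "n \<ge> N" "n \<ge> N1" "n \<ge> N2" by (auto simp: n_def)
    ultimately show False
      using N[of n] N1[of n] N2[of n] by linarith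
  qed
qed

end
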